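(* Let $F$ be a field and let $R$ be a proper subring of $F$ with quotient field $F$. There is a bijection, given by $X\mapsto A(X)$ and $A\mapsto\{A_M: M\in\mathrm{Max}(A)\}$, between the nonempty compact sets $X$ of rank one valuation overrings of $R$ and the one-dimensional Prüfer overrings $A$ of $R$ with nonzero Jacobson radical.
   Context: For a field $F$, $\mathrm{Zar}(F)$ denotes the set of valuation rings of $F$, i.e. the subrings $V$ of $F$ such that for all $0\neq t\in F$, $t\in V$ or $t^{-1}\in V$. The Zariski topology on $\mathrm{Zar}(F)$ has as a basis of open sets the sets $\{V\in\mathrm{Zar}(F): x_1,\ldots,x_n\in V\}$ with $x_1,\ldots,x_n\in F$; subsets carry the subspace topology. Compact means quasicompact (every open cover has a finite subcover) and Hausdorff, with respect to the Zariski topology. A rank one valuation ring is a valuation ring of Krull dimension one. An overring of a domain is a ring between the domain and its quotient field; a valuation overring of $R$ is an overring that is a valuation ring of $F$. For nonempty $X\subseteq\mathrm{Zar}(F)$, $A(X)=\bigcap_{V\in X}V$. $\mathrm{Max}(A)$ is the set of maximal ideals of $A$. A Prüfer domain is an integral domain $A$ such that $A_M$ is a valuation domain for each maximal ideal $M$ of $A$; one-dimensional means of Krull dimension one. Localizations $A_M$ are taken inside $F$. *)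

theory Defs
  imports "HOL-Algebra.Subrings" "HOL-Algebra.Ideal" "HOL-Analysis.T1_Spaces"
    "HOL-Library.Extended_Nat"
begin

text \<open>Throughout, subrings of an ambient field \<open>F\<close> are represented by their carriers;
  \<open>F\<lparr>carrier := A\<rparr>\<close> is the subring \<open>A\<close> as a ring in its own right.\<close>

definition krull_dim :: "('a, 'b) ring_scheme \<Rightarrow> enat" where
  \<comment> \<open>The supremum of the lengths \<open>n\<close> of the chains \<open>P 0 \<subset> P 1 \<subset> \<dots> \<subset> P n\<close> of prime ideals.
    The zero ring, which has no prime ideals, gets the value 0.\<close>
  "krull_dim R = Sup {enat n | n. \<exists>P :: nat \<Rightarrow> 'a set.
     (\<forall>i\<le>n. primeideal (P i) R) \<and> (\<forall>i<n. P i \<subset> P (Suc i))}"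

definition jacobson_radical :: "('a, 'b) ring_scheme \<Rightarrow> 'a set" where
  "jacobson_radical R = carrier R \<inter> \<Inter>{M. maximalideal M R}"

definition quotient_field :: "('a, 'b) ring_scheme \<Rightarrow> 'a set \<Rightarrow> 'a set" where
  "quotient_field F D = {a \<otimes>\<^bsub>F\<^esub> inv\<^bsub>F\<^esub> b | a b. a \<in> D \<and> b \<in> D - {\<zero>\<^bsub>F\<^esub>}}"

definition overrings :: "('a, 'b) ring_scheme \<Rightarrow> 'a set \<Rightarrow> 'a set set" where
  "overrings F R = {A. subring A F \<and> R \<subseteq> A \<and> A \<subseteq> quotient_field F R}"

definition Zar :: "('a, 'b) ring_scheme \<Rightarrow> 'a set set" where
  "Zar F = {V. subring V F \<and> (\<forall>t\<in>carrier F - {\<zero>\<^bsub>F\<^esub>}. t \<in> V \<or> inv\<^bsub>F\<^esub> t \<in> V)}"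

definition zariski_topology :: "('a, 'b) ring_scheme \<Rightarrow> 'a set topology" where
  \<comment> \<open>The generating family is closed under binary intersections and contains \<open>Zar F\<close>
    (take \<open>S = {}\<close>), so it is a basis.\<close>
  "zariski_topology F =
     topology_generated_by {{V \<in> Zar F. S \<subseteq> V} | S. finite S \<and> S \<subseteq> carrier F}"

definition zariski_compact :: "('a, 'b) ring_scheme \<Rightarrow> 'a set set \<Rightarrow> bool" where
  \<comment> \<open>Compact means quasicompact and Hausdorff; \<open>compact_space\<close> alone is quasicompactness.\<close>
  "zariski_compact F X \<longleftrightarrow>
     X \<subseteq> Zar F \<and>
     compact_space (subtopology (zariski_topology F) X) \<and>
     Hausdorff_space (subtopology (zariski_topology F) X)"

definition rank_one_valuation_overrings :: "('a, 'b) ring_scheme \<Rightarrow> 'a set \<Rightarrow> 'a set set" where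
  "rank_one_valuation_overrings F R =
     {V \<in> overrings F R. V \<in> Zar F \<and> krull_dim (F\<lparr>carrier := V\<rparr>) = 1}"

definition valuation_domain :: "('a, 'b) ring_scheme \<Rightarrow> 'a set \<Rightarrow> bool" where
  \<comment> \<open>A valuation ring of its own quotient field, which is formed inside \<open>F\<close>.\<close>
  "valuation_domain F D \<longleftrightarrow> D \<in> Zar (F\<lparr>carrier := quotient_field F D\<rparr>)"

definition max_ideals :: "('a, 'b) ring_scheme \<Rightarrow> 'a set \<Rightarrow> 'a set set" where
  "max_ideals F A = {M. maximalideal M (F\<lparr>carrier := A\<rparr>)}"

definition localization :: "('a, 'b) ring_scheme \<Rightarrow> 'a set \<Rightarrow> 'a set \<Rightarrow> 'a set" where
  "localization F A M = {a \<otimes>\<^bsub>F\<^esub> inv\<^bsub>F\<^esub> s | a s. a \<in> A \<and> s \<in> A - M}"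

definition prufer_domain :: "('a, 'b) ring_scheme \<Rightarrow> 'a set \<Rightarrow> bool" where
  "prufer_domain F A \<longleftrightarrow>
     subdomain A F \<and> (\<forall>M \<in> max_ideals F A. valuation_domain F (localization F A M))"

definition compact_rank_one_sets :: "('a, 'b) ring_scheme \<Rightarrow> 'a set \<Rightarrow> 'a set set set" where
  "compact_rank_one_sets F R =
     {X. X \<noteq> {} \<and> X \<subseteq> rank_one_valuation_overrings F R \<and> zariski_compact F X}"

definition one_dim_prufer_overrings_jac :: "('a, 'b) ring_scheme \<Rightarrow> 'a set \<Rightarrow> 'a set set" where
  "one_dim_prufer_overrings_jac F R =
     {A \<in> overrings F R. prufer_domain F A \<and> krull_dim (F\<lparr>carrier := A\<rparr>) = 1 \<and>
        jacobson_radical (F\<lparr>carrier := A\<rparr>) \<noteq> {\<zero>\<^bsub>F\<^esub>}}"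

definition ring_of_valuations :: "'a set set \<Rightarrow> 'a set" where
  \<comment> \<open>\<open>A(X)\<close>; meant for nonempty \<open>X\<close>.\<close>
  "ring_of_valuations X = (\<Inter>V\<in>X. V)"

definition localizations_at_max :: "('a, 'b) ring_scheme \<Rightarrow> 'a set \<Rightarrow> 'a set set" where
  "localizations_at_max F A = {localization F A M | M. M \<in> max_ideals F A}"

end

theory Submission
  imports Defs "HOL-Algebra.Ring_Divisibility"
begin

text \<open>
  Valuation-theoretically a compact family \<open>X\<close> of rank one valuation rings is tamed by one element:
  some \<open>d \<noteq> \<zero>\<close> lies in the maximal ideal of every \<open>V \<in> X\<close>. It comes from the Hausdorff property.
  Disjoint neighbourhoods of two points say that no member of \<open>X\<close> contains a certain finite set, and
  a denominator \<open>d \<in> R\<close> of that finite set cannot be a unit in any member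
  (\<open>common_nonunit_if_Hausdorff\<close>).

  In rank one, \<open>t\<close> is a nonunit of \<open>V\<close> if and only if \<open>t\<^sup>n / d \<in> V\<close> for some \<open>n\<close>, so being a nonunit at
  \<open>V\<close> is an open condition on \<open>V \<in> X\<close> (\<open>openin_X_nonunit\<close>). Given \<open>t \<in> F\<close>, compactness turns the
  exponents into a single \<open>m\<close> such that \<open>c = d t\<^sup>m\<close> is a nonunit wherever \<open>t\<close> is integral and \<open>1/c\<close> is
  integral wherever \<open>t\<close> is not (\<open>uniform_pole_bound\<close>). Now \<open>ct\<close> has positive value on the first set
  and negative value on the second, never value zero, so that \<open>x = 1/(1 + ct)\<close> and \<open>y = cx\<close> satisfy
  \<open>x + yt = 1\<close> with \<open>x, xt, y, yt\<close> all in \<open>A = A(X)\<close>; moreover \<open>x\<close> is congruent to 1 modulo the maximal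
  ideal where \<open>t\<close> is integral, and to 0 elsewhere (\<open>separation\<close>). This one identity replaces all
  ideal theory of Pruefer domains. It exhibits \<open>t\<close> as a fraction with denominator outside the center
  \<open>M\<close> of \<open>V\<close> on \<open>A\<close>, whence \<open>A\<^sub>M = V\<close>; it inverts elements modulo centers, so that centers are
  maximal; and it combines two elements of an ideal into one that is a unit wherever either is.
  By compactness an ideal contained in no center therefore contains an element that is a unit
  everywhere, that is, a unit of \<open>A\<close>. So the maximal ideals of \<open>A\<close> are the centers, and the
  archimedean property makes every nonzero prime a center.

  In the other direction let \<open>A\<close> be one-dimensional Pruefer and \<open>d \<noteq> \<zero>\<close> in its Jacobson radical. Each
  \<open>A\<^sub>M\<close> is a valuation ring, of rank one because primes of \<open>A\<^sub>M\<close> contract injectively to \<open>A\<close>, and \<open>d\<close>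
  is a common nonunit, which makes \<open>{A\<^sub>M}\<close> Hausdorff by the openness above. Quasicompactness is the
  usual argument for the spectrum of a ring: a basic neighbourhood of \<open>A\<^sub>M\<close> contains all \<open>A\<^sub>N\<close> with
  \<open>s \<notin> N\<close>, for a common denominator \<open>s\<close> of the finitely many defining elements.
\<close>

section \<open>Chains of primes and maximal ideals\<close>

lemma krull_dim_eq_1_iff:
  "krull_dim R = 1 \<longleftrightarrow>
     (\<exists>P Q. primeideal P R \<and> primeideal Q R \<and> P \<subset> Q) \<and>
     \<not> (\<exists>P Q S. primeideal P R \<and> primeideal Q R \<and> primeideal S R \<and> P \<subset> Q \<and> Q \<subset> S)"
  (is "_ \<longleftrightarrow> ?E \<and> \<not> ?C")
proof -
  define L where "L = {enat n | n. \<exists>P :: nat \<Rightarrow> 'a set.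
     (\<forall>i\<le>n. primeideal (P i) R) \<and> (\<forall>i<n. P i \<subset> P (Suc i))}"
  have dim: "krull_dim R = Sup L" by (simp add: krull_dim_def L_def)
  have one: "1 \<in> L" if ?E
  proof -
    from that obtain P Q where PQ: "primeideal P R" "primeideal Q R" "P \<subset> Q" by blast
    then show ?thesis unfolding L_def one_enat_def mem_Collect_eq
      by (intro exI[of _ "1::nat"] conjI exI[of _ "\<lambda>i. if i = 0 then P else Q"]) auto
  qed
  have two: "2 \<in> L" if ?C
  proof -
    from that obtain P Q S
      where PQ: "primeideal P R" "primeideal Q R" "primeideal S R" "P \<subset> Q" "Q \<subset> S" by blast
    have two: "enat 2 = 2" by (simp add: numeral_eq_enat)
    show ?thesis using PQ unfolding L_def mem_Collect_eq
      by (intro exI[of _ "2::nat"] conjI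
            exI[of _ "\<lambda>i. if i = 0 then P else if i = 1 then Q else S"])
         (auto simp: two less_2_cases_iff)
  qed
  have le1: "x \<le> 1" if "\<not> ?C" "x \<in> L" for x
  proof (rule ccontr)
    assume "\<not> x \<le> 1"
    obtain n P where n: "x = enat n" "\<And>i. i \<le> n \<Longrightarrow> primeideal (P i) R"
        "\<And>i. i < n \<Longrightarrow> P i \<subset> P (Suc i)"
      using \<open>x \<in> L\<close> unfolding L_def by blast
    with \<open>\<not> x \<le> 1\<close> have "2 \<le> n" by (simp add: one_enat_def)
    with n(2)[of 0] n(2)[of 1] n(2)[of 2] n(3)[of 0] n(3)[of 1]
    have "primeideal (P 0) R \<and> primeideal (P 1) R \<and> primeideal (P 2) R \<and> P 0 \<subset> P 1 \<and> P 1 \<subset> P 2"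
      by (simp add: numeral_2_eq_2)
    with \<open>\<not> ?C\<close> show False by blast
  qed
  have le0: "x \<le> 0" if "\<not> ?E" "x \<in> L" for x
  proof (rule ccontr)
    assume "\<not> x \<le> 0"
    obtain n P where n: "x = enat n" "\<And>i. i \<le> n \<Longrightarrow> primeideal (P i) R"
        "\<And>i. i < n \<Longrightarrow> P i \<subset> P (Suc i)"
      using \<open>x \<in> L\<close> unfolding L_def by blast
    with \<open>\<not> x \<le> 0\<close> have "1 \<le> n" by (cases n) (auto simp: zero_enat_def)
    with n(2)[of 0] n(2)[of 1] n(3)[of 0]
    have "primeideal (P 0) R \<and> primeideal (P 1) R \<and> P 0 \<subset> P 1" by simp
    with \<open>\<not> ?E\<close> show False by blast
  qed
  show ?thesis
  proof
    assume d1: "krull_dim R = 1"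
    have "?E" using le0 d1 unfolding dim by (metis Sup_least not_one_le_zero)
    moreover have "\<not> ?C"
    proof
      assume ?C
      then have "2 \<le> (1::enat)" using two d1 unfolding dim by (metis Sup_upper)
      then show False by (simp add: one_enat_def numeral_eq_enat)
    qed
    ultimately show "?E \<and> \<not> ?C" by blast
  next
    assume "?E \<and> \<not> ?C"
    then have "Sup L \<le> 1" "1 \<le> Sup L" by (blast intro: Sup_least le1, blast intro: Sup_upper one)
    then show "krull_dim R = 1" unfolding dim by (rule antisym)
  qed
qed

lemma krull_dim_1_no_chain:
  assumes "krull_dim R = 1" "primeideal P R" "primeideal Q R" "primeideal S R" "P \<subset> Q" "Q \<subset> S"
  shows False
  using assms unfolding krull_dim_eq_1_iff by blast

lemma (in ring) exists_maximalideal_above: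
  assumes "ideal I R" "\<one> \<notin> I"
  shows "\<exists>M. maximalideal M R \<and> I \<subseteq> M"
proof -
  define S where "S = {J. ideal J R \<and> I \<subseteq> J \<and> \<one> \<notin> J}"
  have "\<exists>M\<in>S. \<forall>J\<in>S. M \<subseteq> J \<longrightarrow> J = M"
  proof (rule subset_Zorn)
    fix C assume C: "subset.chain S C"
    show "\<exists>U\<in>S. \<forall>J\<in>C. J \<subseteq> U"
    proof (cases "C = {}")
      case True
      then show ?thesis using assms by (auto simp: S_def)
    next
      case False
      from C have "subset.chain {J. ideal J R} C"
        by (auto simp: pred_on.chain_def S_def)
      then have "ideal (\<Union>C) R" using chain_Union_is_ideal[of C] False by simp
      moreover have "I \<subseteq> \<Union>C" "\<one> \<notin> \<Union>C"
        using C False unfolding pred_on.chain_def S_def by blast+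
      ultimately have "\<Union>C \<in> S" by (simp add: S_def)
      then show ?thesis by blast
    qed
  qed
  then obtain M where M: "M \<in> S" "\<And>J. J \<in> S \<Longrightarrow> M \<subseteq> J \<Longrightarrow> J = M" by blast
  have "maximalideal M R"
  proof (rule maximalidealI)
    show "ideal M R" "carrier R \<noteq> M" using M(1) by (auto simp: S_def)
    fix J assume J: "ideal J R" "M \<subseteq> J" "J \<subseteq> carrier R"
    show "J = M \<or> J = carrier R"
    proof (cases "\<one> \<in> J")
      case True then show ?thesis using ideal.one_imp_carrier[OF J(1)] by simp
    next
      case False then show ?thesis using M J by (auto simp: S_def)
    qed
  qed
  with M(1) show ?thesis by (auto simp: S_def)
qed

section \<open>Arithmetic and ideals in subrings of a field\<close>

locale ambient_field = field F for F (structure)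
begin

lemma inv_nonzero:
  assumes "x \<in> carrier F" "x \<noteq> \<zero>"
  shows "inv x \<in> carrier F" "inv x \<noteq> \<zero>" "x \<otimes> inv x = \<one>" "inv x \<otimes> x = \<one>" "inv (inv x) = x"
proof -
  have u: "x \<in> Units F" unfolding field_Units using assms by blast
  show "inv x \<in> carrier F" "x \<otimes> inv x = \<one>" "inv x \<otimes> x = \<one>" "inv (inv x) = x"
    using u by (rule Units_inv_closed, rule Units_r_inv, rule Units_l_inv, rule Units_inv_inv)
  then show "inv x \<noteq> \<zero>" using assms by (metis r_null zero_not_one)
qed

lemma inv_mult:
  assumes "x \<in> carrier F" "x \<noteq> \<zero>" "y \<in> carrier F" "y \<noteq> \<zero>"
  shows "inv (x \<otimes> y) = inv x \<otimes> inv y" "x \<otimes> y \<noteq> \<zero>"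
proof -
  note a = assms inv_nonzero[OF assms(1,2)] inv_nonzero[OF assms(3,4)]
  have "(x \<otimes> y) \<otimes> (inv x \<otimes> inv y) = (x \<otimes> inv x) \<otimes> (y \<otimes> inv y)"
    using a(1,3,5,10) by (simp add: m_ac)
  also have "\<dots> = \<one>" using a by simp
  finally show "inv (x \<otimes> y) = inv x \<otimes> inv y" using a by (intro comm_inv_char) auto
  show "x \<otimes> y \<noteq> \<zero>" using assms integral by blast
qed

lemma mult_inv_cancel:
  assumes "x \<in> carrier F" "y \<in> carrier F" "y \<noteq> \<zero>"
  shows "(x \<otimes> y) \<otimes> inv y = x" "(x \<otimes> inv y) \<otimes> y = x"
  using assms inv_nonzero[OF assms(2,3)] by (simp_all add: m_assoc)

text \<open>Closure under negation is absorbed by multiplication with \<open>\<ominus> \<one>\<close>; the remaining conditions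
  mention only the operations of the ambient field.\<close>

lemma ideal_iff:
  assumes "subring A F"
  shows "ideal I (F\<lparr>carrier := A\<rparr>) \<longleftrightarrow> I \<subseteq> A \<and> \<zero> \<in> I \<and> (\<forall>x\<in>I. \<forall>y\<in>I. x \<oplus> y \<in> I) \<and>
     (\<forall>a\<in>A. \<forall>x\<in>I. a \<otimes> x \<in> I)"
proof -
  note A = subringE[OF assms]
  interpret A: ring "F\<lparr>carrier := A\<rparr>" by (rule subring_is_ring[OF assms])
  show ?thesis
  proof
    assume I: "ideal I (F\<lparr>carrier := A\<rparr>)"
    interpret I: ideal I "F\<lparr>carrier := A\<rparr>" by (rule I)
    show "I \<subseteq> A \<and> \<zero> \<in> I \<and> (\<forall>x\<in>I. \<forall>y\<in>I. x \<oplus> y \<in> I) \<and> (\<forall>a\<in>A. \<forall>x\<in>I. a \<otimes> x \<in> I)"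
      using I.a_subset I.zero_closed I.a_closed I.I_l_closed by simp
  next
    assume I: "I \<subseteq> A \<and> \<zero> \<in> I \<and> (\<forall>x\<in>I. \<forall>y\<in>I. x \<oplus> y \<in> I) \<and> (\<forall>a\<in>A. \<forall>x\<in>I. a \<otimes> x \<in> I)"
    have IF: "x \<in> carrier F" if "x \<in> I" for x using I A(1) that by blast
    have neg: "\<ominus> x \<in> I" if "x \<in> I" for x
    proof -
      have "\<ominus> \<one> \<otimes> x \<in> I" using I that A(3,5) by blast
      then show ?thesis using IF[OF that] by (simp add: l_minus)
    qed
    show "ideal I (F\<lparr>carrier := A\<rparr>)"
    proof (rule idealI)
      show "ring (F\<lparr>carrier := A\<rparr>)" by (rule A.ring_axioms)
      show "subgroup I (add_monoid (F\<lparr>carrier := A\<rparr>))"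
      proof (rule A.add.subgroupI)
        show "\<ominus>\<^bsub>F\<lparr>carrier := A\<rparr>\<^esub> a \<in> I" if "a \<in> I" for a
        proof -
          have "\<ominus>\<^bsub>F\<lparr>carrier := A\<rparr>\<^esub> a = \<ominus> a"
            using that I A IF by (intro A.minus_equality) (auto simp: l_neg)
          then show ?thesis using neg[OF that] by simp
        qed
      qed (use I in auto)
      fix a x assume a: "a \<in> I" "x \<in> carrier (F\<lparr>carrier := A\<rparr>)"
      then have "x \<otimes> a \<in> I" "x \<otimes> a = a \<otimes> x" using I IF[of a] A(1) by (auto intro!: m_comm)
      then show "x \<otimes>\<^bsub>F\<lparr>carrier := A\<rparr>\<^esub> a \<in> I" "a \<otimes>\<^bsub>F\<lparr>carrier := A\<rparr>\<^esub> x \<in> I" by simp_all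
    qed
  qed
qed

lemma subring_cring: "subring A F \<Longrightarrow> cring (F\<lparr>carrier := A\<rparr>)"
  using subcring_iff[OF subringE(1)] subcringI' by blast

lemma primeideal_iff:
  assumes "subring A F"
  shows "primeideal P (F\<lparr>carrier := A\<rparr>) \<longleftrightarrow> ideal P (F\<lparr>carrier := A\<rparr>) \<and> \<one> \<notin> P \<and>
    (\<forall>x\<in>A. \<forall>y\<in>A. x \<otimes> y \<in> P \<longrightarrow> x \<in> P \<or> y \<in> P)"
proof -
  have one: "A \<noteq> P \<longleftrightarrow> \<one> \<notin> P" if P: "ideal P (F\<lparr>carrier := A\<rparr>)"
    using ideal.one_imp_carrier[OF P] subringE(3)[OF assms] by auto
  show ?thesis
    using one subring_cring[OF assms] by (auto simp: primeideal_def primeideal_axioms_def)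
qed

lemma idealD:
  assumes "subring A F" "ideal I (F\<lparr>carrier := A\<rparr>)"
  shows "x \<in> I \<Longrightarrow> x \<in> A" "x \<in> I \<Longrightarrow> x \<in> carrier F" "\<zero> \<in> I"
    "x \<in> I \<Longrightarrow> y \<in> I \<Longrightarrow> x \<oplus> y \<in> I" "a \<in> A \<Longrightarrow> x \<in> I \<Longrightarrow> a \<otimes> x \<in> I"
  using assms(2) subringE(1)[OF assms(1)] unfolding ideal_iff[OF assms(1)] by blast+

text \<open>Maximality as invertibility modulo \<open>M\<close>: this is the form in which the separating elements of a
  compact family verify it, without passing to the quotient ring.\<close>

lemma maximalideal_iff:
  assumes "subring A F"
  shows "maximalideal M (F\<lparr>carrier := A\<rparr>) \<longleftrightarrow> ideal M (F\<lparr>carrier := A\<rparr>) \<and> \<one> \<notin> M \<and>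
    (\<forall>a\<in>A. a \<notin> M \<longrightarrow> (\<exists>b\<in>A. \<one> \<ominus> a \<otimes> b \<in> M))" (is "?L \<longleftrightarrow> ?R")
proof
  note A = subringE[OF assms]
  have AF: "x \<in> carrier F" if "x \<in> A" for x using A(1) that by blast
  {
    assume M: ?L
    interpret M: maximalideal M "F\<lparr>carrier := A\<rparr>" by (rule M)
    have iM: "ideal M (F\<lparr>carrier := A\<rparr>)" by (rule M.is_ideal)
    note I = idealD[OF assms iM]
    have one: "\<one> \<notin> M" using M.one_imp_carrier M.I_notcarr by auto
    have "\<exists>b\<in>A. \<one> \<ominus> a \<otimes> b \<in> M" if a: "a \<in> A" "a \<notin> M" for a
    proof -
      define J where "J = {m \<oplus> a \<otimes> b | m b. m \<in> M \<and> b \<in> A}"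
      have JI: "m \<oplus> a \<otimes> b \<in> J" if "m \<in> M" "b \<in> A" for m b using that unfolding J_def by blast
      have aF: "a \<in> carrier F" using a(1) by (rule AF)
      have "ideal J (F\<lparr>carrier := A\<rparr>)" unfolding ideal_iff[OF assms]
      proof (intro conjI ballI subsetI)
        fix x assume "x \<in> J"
        then obtain m b where "x = m \<oplus> a \<otimes> b" "m \<in> M" "b \<in> A" unfolding J_def by blast
        then show "x \<in> A" using I(1)[of m] a(1) A(6,7) by blast
      next
        show "\<zero> \<in> J" using JI[of \<zero> \<zero>] I(3) A(2) aF by simp
      next
        fix x y assume "x \<in> J" "y \<in> J"
        then obtain m b m' b' where x: "x = m \<oplus> a \<otimes> b" "y = m' \<oplus> a \<otimes> b'"
          "m \<in> M" "b \<in> A" "m' \<in> M" "b' \<in> A" unfolding J_def by blast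
        note c = I(2)[OF x(3)] AF[OF x(4)] I(2)[OF x(5)] AF[OF x(6)] aF
        have "x \<oplus> y = (m \<oplus> m') \<oplus> a \<otimes> (b \<oplus> b')" unfolding x(1,2) using c by algebra
        then show "x \<oplus> y \<in> J" using JI[OF I(4)[OF x(3,5)] A(7)[OF x(4,6)]] by simp
      next
        fix r x assume r: "r \<in> A" "x \<in> J"
        then obtain m b where x: "x = m \<oplus> a \<otimes> b" "m \<in> M" "b \<in> A" unfolding J_def by blast
        note c = I(2)[OF x(2)] AF[OF x(3)] AF[OF r(1)] aF
        have "r \<otimes> x = (r \<otimes> m) \<oplus> a \<otimes> (r \<otimes> b)" unfolding x using c by algebra
        then show "r \<otimes> x \<in> J" using JI[OF I(5)[OF r(1) x(2)] A(6)[OF r(1) x(3)]] by simp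
      qed
      moreover have "M \<subseteq> J"
      proof
        fix m assume "m \<in> M"
        then show "m \<in> J" using JI[OF _ A(2), of m] I(2)[of m] aF by simp
      qed
      moreover have "J \<subseteq> A" using calculation(1) unfolding ideal_iff[OF assms] by blast
      moreover have "a \<in> J" using JI[OF I(3) A(3)] aF by simp
      ultimately have "J = A" using M.I_maximal[of J] a by auto
      then have "\<one> \<in> J" using A(3) by simp
      then obtain m b where x: "\<one> = m \<oplus> a \<otimes> b" "m \<in> M" "b \<in> A" unfolding J_def by blast
      note c = I(2)[OF x(2)] AF[OF x(3)] aF
      have "\<one> \<ominus> a \<otimes> b = m" unfolding x(1) using c by algebra
      then show ?thesis using x(2,3) by auto
    qed
    then show ?R using iM one by blast
  next
    assume h: ?R
    show ?L
    proof (rule maximalidealI)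
      show "ideal M (F\<lparr>carrier := A\<rparr>)" using h by blast
      show "carrier (F\<lparr>carrier := A\<rparr>) \<noteq> M" using h A(3) by auto
      fix J assume J: "ideal J (F\<lparr>carrier := A\<rparr>)" "M \<subseteq> J" "J \<subseteq> carrier (F\<lparr>carrier := A\<rparr>)"
      show "J = M \<or> J = carrier (F\<lparr>carrier := A\<rparr>)"
      proof (rule disjCI)
        assume "J \<noteq> carrier (F\<lparr>carrier := A\<rparr>)"
        then have n1: "\<one> \<notin> J" using ideal.one_imp_carrier[OF J(1)] by auto
        note I = idealD[OF assms J(1)]
        show "J = M"
        proof (rule ccontr)
          assume "J \<noteq> M"
          then obtain a where a: "a \<in> J" "a \<notin> M" using J(2) by blast
          then obtain b where b: "b \<in> A" "\<one> \<ominus> a \<otimes> b \<in> M" using h I(1) by blast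
          note c = AF[OF b(1)] I(2)[OF a(1)]
          have "\<one> = (\<one> \<ominus> a \<otimes> b) \<oplus> b \<otimes> a" using c by algebra
          moreover have "(\<one> \<ominus> a \<otimes> b) \<oplus> b \<otimes> a \<in> J"
            using I(4) I(5)[OF b(1) a(1)] b(2) J(2) by blast
          ultimately show False using n1 by simp
        qed
      qed
    qed
  }
qed

lemma max_ideal_above:
  assumes A: "subring A F" and I: "ideal I (F\<lparr>carrier := A\<rparr>)" "\<one> \<notin> I"
  obtains M where "M \<in> max_ideals F A" "I \<subseteq> M"
  using ring.exists_maximalideal_above[OF subring_is_ring[OF A] I(1)] I(2) unfolding max_ideals_def by auto

lemma max_ideal_prime:
  assumes A: "subring A F" and M: "M \<in> max_ideals F A"
  shows "primeideal M (F\<lparr>carrier := A\<rparr>)"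
  using cring.maximalideal_prime[OF subring_cring[OF A]] M by (simp add: max_ideals_def)

lemma max_ideal_ideal:
  assumes A: "subring A F" and M: "M \<in> max_ideals F A"
  shows "ideal M (F\<lparr>carrier := A\<rparr>)" "\<one> \<notin> M"
  by (rule max_ideal_prime[OF A M, unfolded primeideal_iff[OF A], THEN conjunct1],
      rule max_ideal_prime[OF A M, unfolded primeideal_iff[OF A], THEN conjunct2, THEN conjunct1])

lemma zero_in_max_ideal: "subring A F \<Longrightarrow> M \<in> max_ideals F A \<Longrightarrow> \<zero> \<in> M"
  by (rule idealD(3)[OF _ max_ideal_ideal(1)])

section \<open>Valuation rings and their nonunits\<close>

text \<open>The maximal ideal of a valuation ring. The case \<open>x = \<zero>\<close> is separate because \<open>inv \<zero>\<close> is an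
  unspecified value.\<close>

definition nonunits :: "'a set \<Rightarrow> 'a set" where
  "nonunits V = {x \<in> V. x = \<zero> \<or> inv x \<notin> V}"

lemma subring_if_Zar: "V \<in> Zar F \<Longrightarrow> subring V F"
  by (simp add: Zar_def)

lemma Zar_closed:
  assumes "V \<in> Zar F"
  shows "subring V F" "x \<in> V \<Longrightarrow> x \<in> carrier F" "\<zero> \<in> V" "\<one> \<in> V" "x \<in> V \<Longrightarrow> \<ominus> x \<in> V"
    "x \<in> V \<Longrightarrow> y \<in> V \<Longrightarrow> x \<otimes> y \<in> V" "x \<in> V \<Longrightarrow> y \<in> V \<Longrightarrow> x \<oplus> y \<in> V"
proof -
  show "x \<in> V \<Longrightarrow> x \<in> carrier F" using subringE(1)[OF subring_if_Zar[OF assms]] by (rule subsetD)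
qed (fact subring_if_Zar[OF assms] subringE(2,3,5-7)[OF subring_if_Zar[OF assms]])+

lemma pow_in_subring:
  assumes "subring V F" "x \<in> V" shows "x [^] (n::nat) \<in> V"
  using subringE[OF assms(1)] assms(2) by (induction n) auto

lemma pow_nonzero:
  assumes "x \<in> carrier F" "x \<noteq> \<zero>" shows "x [^] (n::nat) \<noteq> \<zero>"
  using assms by (induction n) (auto simp: integral_iff)

lemma nonunitsD:
  assumes "x \<in> nonunits V"
  shows "x \<in> V" "x \<noteq> \<zero> \<Longrightarrow> inv x \<notin> V"
  using assms by (auto simp: nonunits_def)

lemma unit_inv:
  assumes "x \<in> V" "x \<notin> nonunits V" shows "x \<noteq> \<zero>" "inv x \<in> V"
  using assms by (auto simp: nonunits_def)

lemma inv_in_nonunits: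
  assumes V: "V \<in> Zar F" and x: "x \<in> carrier F" "x \<notin> V"
  shows "x \<noteq> \<zero>" "inv x \<in> nonunits V"
proof -
  show x0: "x \<noteq> \<zero>" using x Zar_closed(3)[OF V] by blast
  then have "inv x \<in> V" using V x by (auto simp: Zar_def)
  then show "inv x \<in> nonunits V" using inv_nonzero[OF x(1) x0] x(2) by (simp add: nonunits_def)
qed

lemma one_notin_nonunits: "V \<in> Zar F \<Longrightarrow> \<one> \<notin> nonunits V"
  using Zar_closed(4) by (simp add: nonunits_def)

lemma nonunits_mult:
  assumes V: "V \<in> Zar F" and "a \<in> V" "x \<in> nonunits V"
  shows "a \<otimes> x \<in> nonunits V"
proof (cases "a \<otimes> x = \<zero>")
  case True
  then show ?thesis using Zar_closed(3)[OF V] by (simp add: nonunits_def)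
next
  case False
  have xV: "x \<in> V" using assms nonunitsD by blast
  have c: "a \<in> carrier F" "x \<in> carrier F" using xV assms Zar_closed(2) by blast+
  then have nz: "a \<noteq> \<zero>" "x \<noteq> \<zero>" using False by auto
  note ia = inv_nonzero[OF c(1) nz(1)] and ix = inv_nonzero[OF c(2) nz(2)]
  have "inv (a \<otimes> x) \<notin> V"
  proof
    assume "inv (a \<otimes> x) \<in> V"
    then have "a \<otimes> inv (a \<otimes> x) \<in> V" using assms Zar_closed(6)[OF V] by blast
    also have "a \<otimes> inv (a \<otimes> x) = (a \<otimes> inv a) \<otimes> inv x"
      using inv_mult(1)[OF c(1) nz(1) c(2) nz(2)] c ia(1) ix(1) by (simp add: m_assoc)
    also have "\<dots> = inv x" using ia ix by simp
    finally show False using nonunitsD(2)[OF assms(3) nz(2)] by simp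
  qed
  then show ?thesis using Zar_closed(6)[OF V] assms(2) xV by (simp add: nonunits_def)
qed

text \<open>One of \<open>x/y\<close> and \<open>y/x\<close> lies in \<open>V\<close>, so the sum is a multiple of \<open>x\<close> or of \<open>y\<close>.\<close>

lemma nonunits_add:
  assumes V: "V \<in> Zar F" and x: "x \<in> nonunits V" and y: "y \<in> nonunits V"
  shows "x \<oplus> y \<in> nonunits V"
proof -
  have c: "x \<in> carrier F" "y \<in> carrier F" using x y nonunitsD(1) Zar_closed(2)[OF V] by blast+
  show ?thesis
  proof (cases "x = \<zero> \<or> y = \<zero>")
    case True
    then show ?thesis using x y c by auto
  next
    case False
    then have nz: "x \<noteq> \<zero>" "y \<noteq> \<zero>" by auto
    note ix = inv_nonzero[OF c(1) nz(1)] and iy = inv_nonzero[OF c(2) nz(2)]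
    have "inv (x \<otimes> inv y) = y \<otimes> inv x"
      using inv_mult(1)[OF c(1) nz(1) iy(1,2)] iy ix c by (simp add: m_comm)
    then have "x \<otimes> inv y \<in> V \<or> y \<otimes> inv x \<in> V"
      using inv_in_nonunits(2)[OF V, of "x \<otimes> inv y"] nonunitsD(1) c iy(1) by fastforce
    then show ?thesis
    proof
      assume "x \<otimes> inv y \<in> V"
      then have "(x \<otimes> inv y \<oplus> \<one>) \<otimes> y \<in> nonunits V"
        by (rule nonunits_mult[OF V Zar_closed(7)[OF V _ Zar_closed(4)[OF V]] y])
      moreover have "(x \<otimes> inv y \<oplus> \<one>) \<otimes> y = x \<oplus> y"
        using c iy by (simp add: l_distr m_assoc)
      ultimately show ?thesis by simp
    next
      assume "y \<otimes> inv x \<in> V"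
      then have "(\<one> \<oplus> y \<otimes> inv x) \<otimes> x \<in> nonunits V"
        by (rule nonunits_mult[OF V Zar_closed(7)[OF V Zar_closed(4)[OF V]] x])
      moreover have "(\<one> \<oplus> y \<otimes> inv x) \<otimes> x = x \<oplus> y"
        using c ix by (simp add: l_distr m_assoc)
      ultimately show ?thesis by simp
    qed
  qed
qed

lemma nonunits_prime:
  assumes V: "V \<in> Zar F" and "x \<in> V" "y \<in> V" "x \<otimes> y \<in> nonunits V"
  shows "x \<in> nonunits V \<or> y \<in> nonunits V"
proof (rule ccontr)
  assume n: "\<not> (x \<in> nonunits V \<or> y \<in> nonunits V)"
  then have u: "x \<noteq> \<zero>" "inv x \<in> V" "y \<noteq> \<zero>" "inv y \<in> V" using unit_inv assms by blast+
  have c: "x \<in> carrier F" "y \<in> carrier F" using assms Zar_closed(2) by blast+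
  have "inv (x \<otimes> y) \<in> V" "x \<otimes> y \<noteq> \<zero>"
    using inv_mult[OF c(1) u(1) c(2) u(3)] Zar_closed(6)[OF V u(2,4)] by simp_all
  then show False using nonunitsD(2)[OF assms(4)] by blast
qed

lemma unit_plus_nonunit:
  assumes V: "V \<in> Zar F" and u: "u \<in> V" "u \<notin> nonunits V" and v: "v \<in> nonunits V"
  shows "u \<oplus> v \<notin> nonunits V"
proof
  assume s: "u \<oplus> v \<in> nonunits V"
  have c: "u \<in> carrier F" "v \<in> carrier F" using Zar_closed(2)[OF V] u(1) nonunitsD(1)[OF v] by blast+
  have "\<ominus> \<one> \<otimes> v \<in> nonunits V"
    by (rule nonunits_mult[OF V Zar_closed(5)[OF V Zar_closed(4)[OF V]] v])
  then have "(u \<oplus> v) \<oplus> \<ominus> \<one> \<otimes> v \<in> nonunits V" by (rule nonunits_add[OF V s])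
  moreover have "(u \<oplus> v) \<oplus> \<ominus> \<one> \<otimes> v = u" using c by algebra
  ultimately show False using u(2) by simp
qed

lemma unit_one_plus:
  assumes V: "V \<in> Zar F" and x: "x \<in> nonunits V"
  shows "\<one> \<oplus> x \<noteq> \<zero>" "inv (\<one> \<oplus> x) \<in> V"
  using unit_inv[OF Zar_closed(7)[OF V Zar_closed(4)[OF V] nonunitsD(1)[OF x]]
      unit_plus_nonunit[OF V Zar_closed(4)[OF V] one_notin_nonunits[OF V] x]] .

lemma nonunits_primeideal:
  assumes V: "V \<in> Zar F"
  shows "primeideal (nonunits V) (F\<lparr>carrier := V\<rparr>)"
  unfolding primeideal_iff[OF Zar_closed(1)[OF V]] ideal_iff[OF Zar_closed(1)[OF V]]
proof (intro conjI ballI impI subsetI)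
  show "\<zero> \<in> nonunits V" using Zar_closed(3)[OF V] by (simp add: nonunits_def)
qed (fact nonunitsD(1) nonunits_add[OF V] nonunits_mult[OF V] one_notin_nonunits[OF V]
      nonunits_prime[OF V])+

lemma proper_ideal_subset_nonunits:
  assumes V: "V \<in> Zar F" and P: "ideal P (F\<lparr>carrier := V\<rparr>)" "\<one> \<notin> P"
  shows "P \<subseteq> nonunits V"
proof
  fix x assume x: "x \<in> P"
  note I = idealD[OF Zar_closed(1)[OF V] P(1)]
  show "x \<in> nonunits V"
  proof (rule ccontr)
    assume "x \<notin> nonunits V"
    then have u: "x \<noteq> \<zero>" "inv x \<in> V" using unit_inv I(1)[OF x] by blast+
    then have "inv x \<otimes> x \<in> P" using I(5) x by blast
    then show False using inv_nonzero(4)[OF I(2)[OF x] u(1)] P(2) by simp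
  qed
qed

lemma zero_prime: "subring A F \<Longrightarrow> primeideal {\<zero>} (F\<lparr>carrier := A\<rparr>)"
  using domain.zeroprimeideal[OF subring_is_domain, of A] by simp

text \<open>The archimedean property of the value group, \<open>n v(t) \<ge> v(d)\<close> for some \<open>n\<close>, written without
  mentioning values.\<close>

definition rank_one :: "'a set \<Rightarrow> bool" where
  "rank_one V \<longleftrightarrow> V \<in> Zar F \<and> V \<noteq> carrier F \<and>
     (\<forall>t\<in>nonunits V. \<forall>d\<in>nonunits V. d \<noteq> \<zero> \<longrightarrow> (\<exists>n::nat. t [^] n \<otimes> inv d \<in> V))"

lemma rank_oneD:
  assumes "rank_one V"
  shows "V \<in> Zar F" "V \<noteq> carrier F"
    "t \<in> nonunits V \<Longrightarrow> d \<in> nonunits V \<Longrightarrow> d \<noteq> \<zero> \<Longrightarrow> \<exists>n::nat. t [^] n \<otimes> inv d \<in> V"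
  using assms by (auto simp: rank_one_def)

text \<open>If no power of \<open>t\<close> is divisible by \<open>d\<close>, the elements divisible by all powers of \<open>t\<close> form a prime
  that contains \<open>d\<close> but not \<open>t\<close>, strictly between \<open>\<zero>\<close> and the nonunits.\<close>

lemma rank_one_if_krull_dim_1:
  assumes V: "V \<in> Zar F" and dim: "krull_dim (F\<lparr>carrier := V\<rparr>) = 1"
  shows "rank_one V"
proof -
  note sV = Zar_closed(1)[OF V]
  have E: "\<exists>P Q. primeideal P (F\<lparr>carrier := V\<rparr>) \<and> primeideal Q (F\<lparr>carrier := V\<rparr>) \<and> P \<subset> Q"
    and C: "primeideal P (F\<lparr>carrier := V\<rparr>) \<Longrightarrow> primeideal Q (F\<lparr>carrier := V\<rparr>) \<Longrightarrow>
      primeideal S (F\<lparr>carrier := V\<rparr>) \<Longrightarrow> P \<subset> Q \<Longrightarrow> Q \<subset> S \<Longrightarrow> False" for P Q S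
    using dim unfolding krull_dim_eq_1_iff by blast+
  have "V \<noteq> carrier F"
  proof
    assume eq: "V = carrier F"
    obtain P Q where PQ: "ideal P (F\<lparr>carrier := V\<rparr>)" "ideal Q (F\<lparr>carrier := V\<rparr>)" "\<one> \<notin> Q" "P \<subset> Q"
      using E unfolding primeideal_iff[OF sV] by blast
    then obtain x where x: "x \<in> Q" "x \<notin> P" by blast
    then have "x \<noteq> \<zero>" using idealD(3)[OF sV PQ(1)] by blast
    moreover have "x \<in> nonunits V" using proper_ideal_subset_nonunits[OF V PQ(2,3)] x by blast
    ultimately show False using nonunitsD[of x V] inv_nonzero(1)[of x] eq by blast
  qed
  moreover have "\<exists>n::nat. t [^] n \<otimes> inv d \<in> V"
    if t: "t \<in> nonunits V" and d: "d \<in> nonunits V" "d \<noteq> \<zero>" for t d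
  proof (rule ccontr)
    assume no: "\<nexists>n::nat. t [^] n \<otimes> inv d \<in> V"
    have c: "t \<in> carrier F" "d \<in> carrier F" using t d nonunitsD(1) Zar_closed(2)[OF V] by blast+
    have t0: "t \<noteq> \<zero>"
    proof
      assume "t = \<zero>"
      then have "t [^] (1::nat) \<otimes> inv d \<in> V" using Zar_closed(3)[OF V] inv_nonzero(1)[OF c(2) d(2)] by simp
      then show False using no by blast
    qed
    note it = inv_nonzero[OF c(1) t0] and id = inv_nonzero[OF c(2) d(2)]
    define s where "s = inv t"
    have s: "s \<in> carrier F" "s \<noteq> \<zero>" using it by (simp_all add: s_def)
    have ts: "t [^] n \<otimes> s [^] n = \<one>" for n :: nat
      using c(1) s(1) it(3) by (simp add: s_def flip: nat_pow_distrib)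
    have sn: "inv (s [^] n) = t [^] n" for n :: nat
      using ts[of n] c(1) s(1) by (intro comm_inv_char) (auto simp: m_comm)
    \<comment> \<open>With \<open>s = 1/t\<close>: the elements of \<open>V\<close> divisible by every power of \<open>t\<close>.\<close>
    define P where "P = {x \<in> carrier F. \<forall>n::nat. x \<otimes> s [^] n \<in> V}"
    have PV: "P \<subseteq> V"
    proof
      fix x assume "x \<in> P"
      then have "x \<in> carrier F" "x \<otimes> s [^] (0::nat) \<in> V" unfolding P_def by blast+
      then show "x \<in> V" by simp
    qed
    have dP: "d \<in> P"
    proof -
      have "d \<otimes> s [^] n \<in> V" for n :: nat
      proof (rule ccontr)
        assume "d \<otimes> s [^] n \<notin> V"
        then have "inv (d \<otimes> s [^] n) \<in> V" using inv_in_nonunits(2)[OF V, of "d \<otimes> s [^] n"] nonunitsD(1) c s by simp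
        also have "inv (d \<otimes> s [^] n) = t [^] n \<otimes> inv d"
          using inv_mult(1)[OF c(2) d(2) nat_pow_closed[OF s(1)] pow_nonzero[OF s]] sn c id(1)
          by (simp add: m_comm)
        finally show False using no by blast
      qed
      then show ?thesis using c by (simp add: P_def)
    qed
    have tP: "t \<notin> P"
    proof
      \<comment> \<open>Divisibility of \<open>t\<close> by \<open>t\<^sup>2\<close> would make \<open>t\<close> a unit.\<close>
      assume "t \<in> P"
      then have "t \<otimes> s [^] (2::nat) \<in> V" by (simp add: P_def)
      also have "t \<otimes> s [^] (2::nat) = (t \<otimes> s) \<otimes> s"
        using c s by (simp add: numeral_2_eq_2 m_assoc)
      also have "\<dots> = inv t" using it by (simp add: s_def)
      finally show False using nonunitsD(2)[OF t t0] by blast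
    qed
    have "primeideal P (F\<lparr>carrier := V\<rparr>)"
      unfolding primeideal_iff[OF sV] ideal_iff[OF sV]
    proof (intro conjI ballI impI)
      show "P \<subseteq> V" by (rule PV)
      show "\<zero> \<in> P" using s Zar_closed(3)[OF V] by (simp add: P_def)
      show "x \<oplus> y \<in> P" if "x \<in> P" "y \<in> P" for x y
        using that s Zar_closed(7)[OF V] by (simp add: P_def l_distr)
      show "a \<otimes> x \<in> P" if "a \<in> V" "x \<in> P" for a x
        using that s Zar_closed(2,6)[OF V] by (simp add: P_def m_assoc)
      show "\<one> \<notin> P"
      proof
        assume "\<one> \<in> P"
        then have "\<one> \<otimes> s [^] (1::nat) \<in> V" unfolding P_def by blast
        then show False using nonunitsD(2)[OF t t0] it by (simp add: s_def)
      qed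
      show "x \<in> P \<or> y \<in> P" if xy: "x \<in> V" "y \<in> V" "x \<otimes> y \<in> P" for x y
      proof (rule ccontr)
        assume "\<not> (x \<in> P \<or> y \<in> P)"
        moreover have cx: "x \<in> carrier F" "y \<in> carrier F" using xy Zar_closed(2)[OF V] by blast+
        ultimately obtain m n :: nat where mn: "x \<otimes> s [^] m \<notin> V" "y \<otimes> s [^] n \<notin> V"
          unfolding P_def by blast
        have c2: "x \<otimes> s [^] m \<in> carrier F" "y \<otimes> s [^] n \<in> carrier F" using cx s by auto
        note i = inv_in_nonunits[OF V c2(1) mn(1)] inv_in_nonunits[OF V c2(2) mn(2)]
        have "inv (x \<otimes> s [^] m) \<otimes> inv (y \<otimes> s [^] n) \<in> nonunits V"
          using nonunits_mult[OF V nonunitsD(1)[OF i(2)] i(4)] .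
        then have u: "inv ((x \<otimes> s [^] m) \<otimes> (y \<otimes> s [^] n)) \<in> nonunits V"
          using inv_mult[OF c2(1) i(1) c2(2) i(3)] by simp
        have "(x \<otimes> s [^] m) \<otimes> (y \<otimes> s [^] n) = (x \<otimes> y) \<otimes> s [^] (m + n)"
          using cx s by (simp add: nat_pow_mult[symmetric] m_ac)
        also have "\<dots> \<in> V" using xy(3) by (simp add: P_def)
        finally have w: "(x \<otimes> s [^] m) \<otimes> (y \<otimes> s [^] n) \<in> V" .
        have nz: "(x \<otimes> s [^] m) \<otimes> (y \<otimes> s [^] n) \<noteq> \<zero>" using inv_mult[OF c2(1) i(1) c2(2) i(3)] by simp
        have "\<one> \<in> nonunits V"
          using nonunits_mult[OF V w u] inv_nonzero(3)[OF _ nz] c2 by simp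
        then show False using one_notin_nonunits[OF V] by blast
      qed
    qed
    moreover have "{\<zero>} \<subset> P" using dP d(2) idealD(3)[OF sV] calculation
      unfolding primeideal_iff[OF sV] by blast
    moreover have "P \<subset> nonunits V" using calculation(1) proper_ideal_subset_nonunits[OF V] tP t
      unfolding primeideal_iff[OF sV] by blast
    ultimately show False
      using C[OF zero_prime[OF sV] _ nonunits_primeideal[OF V]] by blast
  qed
  ultimately show ?thesis using V by (auto simp: rank_one_def)
qed

lemma rank_one_nonunit:
  assumes "rank_one V"
  obtains d where "d \<in> nonunits V" "d \<noteq> \<zero>"
proof -
  note V = rank_oneD(1)[OF assms]
  obtain f where f: "f \<in> carrier F" "f \<notin> V"
    using rank_oneD(2)[OF assms] Zar_closed(2)[OF V] by blast
  show ?thesis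
    using that[of "inv f"] inv_in_nonunits[OF V f] inv_nonzero(2)[OF f(1)] by blast
qed

text \<open>If \<open>f \<in> W - V\<close> then \<open>1/f\<close> is a nonunit of \<open>V\<close>, so a high power of \<open>1/f\<close> clears the denominator of
  any given \<open>g\<close>, and the corresponding power of \<open>f\<close>, which lies in \<open>W\<close>, puts \<open>g\<close> back into \<open>W\<close>.\<close>

lemma rank_one_maximal_subring:
  assumes V: "rank_one V" and W: "subring W F" "V \<subseteq> W" "W \<noteq> carrier F"
  shows "V = W"
proof (rule ccontr)
  note VZ = rank_oneD(1)[OF V] and W' = subringE[OF W(1)]
  assume "V \<noteq> W"
  then obtain f where f: "f \<in> W" "f \<notin> V" using W by blast
  have fF: "f \<in> carrier F" using f W' by blast
  note i = inv_in_nonunits[OF VZ fF f(2)]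
  have "g \<in> W" if g: "g \<in> carrier F" for g
  proof (cases "g \<in> V")
    case True
    then show ?thesis using W by blast
  next
    case False
    note ig = inv_in_nonunits[OF VZ g False]
    obtain n :: nat where n: "(inv f) [^] n \<otimes> inv (inv g) \<in> V"
      using rank_oneD(3)[OF V i(2) ig(2)] inv_nonzero(2)[OF g ig(1)] by blast
    have "f [^] n \<otimes> ((inv f) [^] n \<otimes> g) \<in> W"
      using n inv_nonzero(5)[OF g ig(1)] W' W(2) pow_in_subring[OF W(1) f(1)] by auto
    also have "f [^] n \<otimes> ((inv f) [^] n \<otimes> g) = (f \<otimes> inv f) [^] n \<otimes> g"
      using fF inv_nonzero(1)[OF fF i(1)] g by (simp add: nat_pow_distrib m_assoc)
    also have "\<dots> = g" using inv_nonzero(3)[OF fF i(1)] g by simp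
    finally show ?thesis .
  qed
  then show False using W W' by blast
qed

section \<open>Localizations inside the ambient field\<close>

text \<open>Describing fractions by \<open>s \<otimes> x \<in> A\<close> instead of \<open>x = a \<otimes> inv s\<close> keeps inverses out of the
  arguments about localizations.\<close>

lemma localization_iff:
  assumes "subring A F" "\<zero> \<in> P"
  shows "x \<in> localization F A P \<longleftrightarrow> x \<in> carrier F \<and> (\<exists>s\<in>A - P. s \<otimes> x \<in> A)"
proof
  note AF = subsetD[OF subringE(1)[OF assms(1)]]
  assume "x \<in> localization F A P"
  then obtain a s where x: "x = a \<otimes> inv s" "a \<in> A" "s \<in> A - P" unfolding localization_def by blast
  have s: "s \<in> carrier F" "s \<noteq> \<zero>" using x AF assms(2) by auto
  note i = inv_nonzero[OF s] and a = AF[OF x(2)]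
  have "s \<otimes> x = (s \<otimes> inv s) \<otimes> a" unfolding x(1) using s(1) i(1) a by (simp add: m_ac)
  then have "s \<otimes> x \<in> A" using i a x(2) by simp
  then show "x \<in> carrier F \<and> (\<exists>s\<in>A - P. s \<otimes> x \<in> A)" using x i a by auto
next
  note AF = subsetD[OF subringE(1)[OF assms(1)]]
  assume x: "x \<in> carrier F \<and> (\<exists>s\<in>A - P. s \<otimes> x \<in> A)"
  then obtain s where s: "s \<in> A - P" "s \<otimes> x \<in> A" by blast
  have c: "s \<in> carrier F" "s \<noteq> \<zero>" using s AF assms(2) by auto
  note i = inv_nonzero[OF c]
  have "x = (s \<otimes> x) \<otimes> inv s" using mult_inv_cancel(1)[of x s] m_comm[of s x] c x by simp
  then show "x \<in> localization F A P" using s unfolding localization_def by blast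
qed

lemma prime_mult_closed:
  assumes "subring A F" "primeideal P (F\<lparr>carrier := A\<rparr>)" "s \<in> A - P" "t \<in> A - P"
  shows "s \<otimes> t \<in> A - P"
  using assms(2-) subringE(6)[OF assms(1)] unfolding primeideal_iff[OF assms(1)] by blast

text \<open>For \<open>P = {\<zero>}\<close> these are common denominators in the quotient field.\<close>

lemma localization_common_denominator:
  assumes A: "subring A F" and P: "primeideal P (F\<lparr>carrier := A\<rparr>)"
    and S: "finite S" "S \<subseteq> localization F A P"
  shows "\<exists>s\<in>A - P. \<forall>x\<in>S. s \<otimes> x \<in> A"
  using S
proof (induction S rule: finite_induct)
  case empty
  then show ?case using P subringE(3)[OF A] unfolding primeideal_iff[OF A] by blast
next
  case (insert x S)
  note AF = subsetD[OF subringE(1)[OF A]]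
  have z: "\<zero> \<in> P" using P idealD(3)[OF A] unfolding primeideal_iff[OF A] by blast
  obtain s where s: "s \<in> A - P" "\<forall>x\<in>S. s \<otimes> x \<in> A" using insert by blast
  obtain t where t: "t \<in> A - P" "t \<otimes> x \<in> A" and xF: "x \<in> carrier F"
    using insert.prems unfolding localization_iff[OF A z] subset_eq by blast
  have c: "s \<in> carrier F" "t \<in> carrier F" using s t AF by auto
  have "s \<otimes> t \<otimes> y \<in> A" if y: "y \<in> insert x S" for y
  proof (cases "y = x")
    case True
    then have "s \<otimes> t \<otimes> y = s \<otimes> (t \<otimes> x)" using c xF by (simp add: m_assoc)
    then show ?thesis using subringE(6)[OF A] s t by simp
  next
    case False
    then have "y \<in> S" using y by blast
    moreover have "y \<in> carrier F"
      using insert.prems y unfolding localization_iff[OF A z] subset_eq by blast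
    ultimately have "s \<otimes> t \<otimes> y = t \<otimes> (s \<otimes> y)" "s \<otimes> y \<in> A" using c s by (simp_all add: m_ac)
    then show ?thesis using subringE(6)[OF A] t by simp
  qed
  then show ?case using prime_mult_closed[OF A P s(1) t(1)] by blast
qed

lemma localization_overring:
  assumes A: "subring A F" and P: "primeideal P (F\<lparr>carrier := A\<rparr>)"
  shows "subring (localization F A P) F" "A \<subseteq> localization F A P"
proof -
  note AF = subsetD[OF subringE(1)[OF A]]
  have z: "\<zero> \<in> P" and one: "\<one> \<in> A - P"
    using P idealD(3)[OF A] subringE(3)[OF A] unfolding primeideal_iff[OF A] by blast+
  note loc = localization_iff[OF A z]
  show AL: "A \<subseteq> localization F A P"
  proof
    fix a assume "a \<in> A"
    then show "a \<in> localization F A P" unfolding loc using one AF[of a] by (intro conjI bexI[of _ \<one>]) auto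
  qed
  show "subring (localization F A P) F"
  proof (rule subringI)
    show "localization F A P \<subseteq> carrier F" using loc by blast
    show "\<one> \<in> localization F A P" using AL one by blast
    fix x assume x: "x \<in> localization F A P"
    then obtain s where s: "s \<in> A - P" "s \<otimes> x \<in> A" and xF: "x \<in> carrier F" unfolding loc by blast
    have sF: "s \<in> carrier F" using s AF by blast
    have "s \<otimes> (\<ominus> x) = \<ominus> (s \<otimes> x)" using sF xF by algebra
    then show "\<ominus> x \<in> localization F A P"
      unfolding loc using s xF subringE(5)[OF A s(2)] by (intro conjI bexI[of _ s]) auto
    fix y assume y: "y \<in> localization F A P"
    then obtain t where t: "t \<in> A - P" "t \<otimes> y \<in> A" and yF: "y \<in> carrier F" unfolding loc by blast
    have tF: "t \<in> carrier F" using t AF by blast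
    note st = prime_mult_closed[OF A P s(1) t(1)]
    have "(s \<otimes> t) \<otimes> (x \<otimes> y) = (s \<otimes> x) \<otimes> (t \<otimes> y)" using sF tF xF yF by (simp add: m_ac)
    then show "x \<otimes> y \<in> localization F A P"
      unfolding loc using st xF yF subringE(6)[OF A s(2) t(2)] by (intro conjI bexI[of _ "s \<otimes> t"]) auto
    have "(s \<otimes> t) \<otimes> (x \<oplus> y) = t \<otimes> (s \<otimes> x) \<oplus> s \<otimes> (t \<otimes> y)" using sF tF xF yF by algebra
    moreover have "t \<otimes> (s \<otimes> x) \<oplus> s \<otimes> (t \<otimes> y) \<in> A"
      using subringE(6)[OF A _ s(2), of t] subringE(6)[OF A _ t(2), of s] s(1) t(1)
      by (intro subringE(7)[OF A]) auto
    ultimately show "x \<oplus> y \<in> localization F A P"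
      unfolding loc using st xF yF by (intro conjI bexI[of _ "s \<otimes> t"]) auto
  qed
qed

lemma localization_subset_valuation_ring:
  assumes A: "subring A F" "\<zero> \<in> P" and V: "V \<in> Zar F" "A \<subseteq> V" "nonunits V \<inter> A \<subseteq> P"
  shows "localization F A P \<subseteq> V"
proof
  fix x assume "x \<in> localization F A P"
  then obtain s where s: "s \<in> A - P" "s \<otimes> x \<in> A" and x: "x \<in> carrier F"
    unfolding localization_iff[OF A] by blast
  have sV: "s \<in> V" "s \<notin> nonunits V" using s V by blast+
  note u = unit_inv[OF sV] and sF = Zar_closed(2)[OF V(1) sV(1)]
  note i = inv_nonzero[OF sF u(1)]
  have "inv s \<otimes> (s \<otimes> x) \<in> V" using Zar_closed(6)[OF V(1) u(2)] s(2) V(2) by blast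
  also have "inv s \<otimes> (s \<otimes> x) = (inv s \<otimes> s) \<otimes> x" using sF i(1) x by (simp add: m_assoc)
  also have "\<dots> = x" using i x by simp
  finally show "x \<in> V" .
qed

text \<open>The denominators are the elements of \<open>A\<close> that become units, so contracting the nonunits recovers
  \<open>P\<close>.\<close>

lemma nonunits_localization:
  assumes A: "subring A F" and P: "primeideal P (F\<lparr>carrier := A\<rparr>)"
  shows "nonunits (localization F A P) \<inter> A = P"
proof -
  note AF = subsetD[OF subringE(1)[OF A]]
  have iP: "ideal P (F\<lparr>carrier := A\<rparr>)" using P unfolding primeideal_iff[OF A] by blast
  note I = idealD[OF A iP]
  note loc = localization_iff[OF A I(3)]
  show ?thesis
  proof (intro equalityI subsetI)
    fix a assume a: "a \<in> nonunits (localization F A P) \<inter> A"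
    show "a \<in> P"
    proof (rule ccontr)
      assume "a \<notin> P"
      then have a0: "a \<noteq> \<zero>" and aA: "a \<in> A - P" using a I(3) by blast+
      note i = inv_nonzero[OF AF a0]
      have "inv a \<in> localization F A P" unfolding loc
        using aA i(1,3) subringE(3)[OF A] by (intro conjI bexI[of _ a]) auto
      then show False using a a0 by (auto simp: nonunits_def)
    qed
  next
    fix a assume a: "a \<in> P"
    have aA: "a \<in> A" and aF: "a \<in> carrier F" using I(1,2)[OF a] by blast+
    have "inv a \<notin> localization F A P" if a0: "a \<noteq> \<zero>"
    proof
      assume "inv a \<in> localization F A P"
      then obtain s where s: "s \<in> A - P" "s \<otimes> inv a \<in> A" unfolding loc by blast
      then have "s \<otimes> inv a \<otimes> a \<in> P" using I(5) a by blast
      then show False using mult_inv_cancel(2)[OF _ aF a0, of s] s AF by simp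
    qed
    then show "a \<in> nonunits (localization F A P) \<inter> A"
      using aA localization_overring(2)[OF A P] by (auto simp: nonunits_def)
  qed
qed

lemma quotient_field_overring:
  assumes "subring B F" "R \<subseteq> B" "quotient_field F R = carrier F"
  shows "quotient_field F B = carrier F"
proof
  show "carrier F \<subseteq> quotient_field F B"
    unfolding assms(3)[symmetric] quotient_field_def using assms(2) by blast
  show "quotient_field F B \<subseteq> carrier F"
    unfolding quotient_field_def using subsetD[OF subringE(1)[OF assms(1)]] inv_nonzero(1) by blast
qed

lemma valuation_domain_iff:
  assumes "quotient_field F B = carrier F"
  shows "valuation_domain F B \<longleftrightarrow> B \<in> Zar F"
  unfolding valuation_domain_def assms by simp

lemma contraction_prime:
  assumes A: "subring A F" and B: "subring B F" "A \<subseteq> B" and Q: "primeideal Q (F\<lparr>carrier := B\<rparr>)"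
  shows "primeideal (Q \<inter> A) (F\<lparr>carrier := A\<rparr>)"
proof -
  have iQ: "ideal Q (F\<lparr>carrier := B\<rparr>)" and one: "\<one> \<notin> Q"
    and pr: "x \<in> B \<Longrightarrow> y \<in> B \<Longrightarrow> x \<otimes> y \<in> Q \<Longrightarrow> x \<in> Q \<or> y \<in> Q" for x y
    using Q unfolding primeideal_iff[OF B(1)] by blast+
  note I = idealD[OF B(1) iQ] and A' = subringE[OF A]
  show ?thesis unfolding primeideal_iff[OF A] ideal_iff[OF A]
  proof (intro conjI ballI impI)
    show "\<zero> \<in> Q \<inter> A" using I(3) A'(2) by blast
    show "x \<oplus> y \<in> Q \<inter> A" if "x \<in> Q \<inter> A" "y \<in> Q \<inter> A" for x y
      using that I(4)[of x y] A'(7)[of x y] by simp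
    show "a \<otimes> x \<in> Q \<inter> A" if "a \<in> A" "x \<in> Q \<inter> A" for a x
      using that I(5)[of a x] A'(6)[of a x] B(2) by auto
    show "\<one> \<notin> Q \<inter> A" using one by blast
    show "x \<in> Q \<inter> A \<or> y \<in> Q \<inter> A" if "x \<in> A" "y \<in> A" "x \<otimes> y \<in> Q \<inter> A" for x y
      using that pr[of x y] B(2) by blast
  qed simp
qed

text \<open>An element of the larger ideal outside the smaller one can be multiplied into \<open>A\<close> by its
  denominator, which is a unit of the localization.\<close>

lemma contraction_strict_mono:
  assumes A: "subring A F" and P: "primeideal P (F\<lparr>carrier := A\<rparr>)"
    and Q: "ideal Q (F\<lparr>carrier := localization F A P\<rparr>)"
    and Q': "ideal Q' (F\<lparr>carrier := localization F A P\<rparr>)" and less: "Q \<subset> Q'"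
  shows "Q \<inter> A \<subset> Q' \<inter> A"
proof -
  note L = localization_overring[OF A P]
  note I = idealD[OF L(1) Q] and I' = idealD[OF L(1) Q']
  have "\<zero> \<in> P" using P idealD(3)[OF A] unfolding primeideal_iff[OF A] by blast
  note loc = localization_iff[OF A this]
  obtain x where x: "x \<in> Q'" "x \<notin> Q" using less by blast
  then obtain s where s: "s \<in> A - P" "s \<otimes> x \<in> A" and xF: "x \<in> carrier F"
    using I'(1)[OF x(1)] unfolding loc by blast
  have sL: "s \<in> localization F A P" "s \<notin> nonunits (localization F A P)"
    using s(1) L(2) nonunits_localization[OF A P] by blast+
  note u = unit_inv[OF sL]
  have sF: "s \<in> carrier F" using s(1) subringE(1)[OF A] by blast
  have "s \<otimes> x \<in> Q'" using I'(5)[OF sL(1) x(1)] .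
  moreover have "s \<otimes> x \<notin> Q"
  proof
    assume "s \<otimes> x \<in> Q"
    then have "inv s \<otimes> (s \<otimes> x) \<in> Q" by (rule I(5)[OF u(2)])
    moreover have "inv s \<otimes> (s \<otimes> x) = x"
      using inv_nonzero[OF sF u(1)] sF xF by (simp flip: m_assoc)
    ultimately show False using x(2) by simp
  qed
  ultimately show ?thesis using less s(2) by blast
qed

section \<open>The Zariski topology\<close>

lemma openin_zariski_member: "t \<in> carrier F \<Longrightarrow> openin (zariski_topology F) {V \<in> Zar F. t \<in> V}"
  unfolding zariski_topology_def
  by (rule topology_generated_by_Basis) (auto intro!: exI[of _ "{t}"])

lemma topspace_zariski: "topspace (zariski_topology F) = Zar F"
proof
  show "topspace (zariski_topology F) \<subseteq> Zar F"
    unfolding zariski_topology_def topology_generated_by_topspace by (rule Union_least) auto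
  have "{V \<in> Zar F. \<one> \<in> V} \<subseteq> topspace (zariski_topology F)"
    by (rule openin_subset[OF openin_zariski_member]) simp
  then show "Zar F \<subseteq> topspace (zariski_topology F)" using Zar_closed(4) by blast
qed

lemma zariski_basic_nbhd:
  assumes "openin (zariski_topology F) U" "V \<in> U"
  shows "\<exists>S. finite S \<and> S \<subseteq> V \<and> {W \<in> Zar F. S \<subseteq> W} \<subseteq> U"
proof -
  have "generate_topology_on {{V \<in> Zar F. S \<subseteq> V} | S. finite S \<and> S \<subseteq> carrier F} U"
    using assms(1) unfolding zariski_topology_def by (rule openin_topology_generated_by)
  then show ?thesis using assms(2)
  proof (induction U)
    case Empty
    then show ?case by simp
  next
    case (Int a b)
    have "V \<in> a" "V \<in> b" using Int.prems by auto
    obtain S where "finite S" "S \<subseteq> V" "{W \<in> Zar F. S \<subseteq> W} \<subseteq> a"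
      using Int.IH(1)[OF \<open>V \<in> a\<close>] by (elim exE conjE)
    moreover obtain T where "finite T" "T \<subseteq> V" "{W \<in> Zar F. T \<subseteq> W} \<subseteq> b"
      using Int.IH(2)[OF \<open>V \<in> b\<close>] by (elim exE conjE)
    ultimately show ?case by (intro exI[of _ "S \<union> T"]) auto
  next
    case (UN K)
    then obtain k where k: "k \<in> K" "V \<in> k" by blast
    then obtain S where "finite S" "S \<subseteq> V" "{W \<in> Zar F. S \<subseteq> W} \<subseteq> k" using UN.IH[OF k] by blast
    then show ?case using k by blast
  next
    case (Basis s)
    then show ?case by blast
  qed
qed

end

text \<open>In this form compactness replaces a choice depending on the point by a uniform one; it is applied
  to covers indexed by an exponent and by the elements of an ideal.\<close>

lemma compact_space_directed_cover:
  assumes T: "compact_space T" and I: "I \<noteq> {}"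
    and op: "\<And>i. i \<in> I \<Longrightarrow> openin T (U i)"
    and cover: "\<And>x. x \<in> topspace T \<Longrightarrow> \<exists>i\<in>I. x \<in> U i"
    and dir: "\<And>i j. i \<in> I \<Longrightarrow> j \<in> I \<Longrightarrow> \<exists>k\<in>I. U i \<union> U j \<subseteq> U k"
  shows "\<exists>i\<in>I. topspace T \<subseteq> U i"
proof -
  obtain \<F> where \<F>: "finite \<F>" "\<F> \<subseteq> U ` I" "topspace T \<subseteq> \<Union>\<F>"
  proof -
    have "\<forall>W\<in>U ` I. openin T W" "topspace T \<subseteq> \<Union>(U ` I)" using op cover by auto
    then have "\<exists>\<F>. finite \<F> \<and> \<F> \<subseteq> U ` I \<and> topspace T \<subseteq> \<Union>\<F>"
      using T[unfolded compact_space_alt, THEN spec, of "U ` I"] by (simp only:)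
    then show ?thesis using that by (elim exE conjE)
  qed
  have "\<exists>i\<in>I. \<Union>\<F> \<subseteq> U i" using \<F>(1,2)
  proof (induction \<F> rule: finite_induct)
    case empty
    then show ?case using I by auto
  next
    case (insert a \<F>)
    have "\<F> \<subseteq> U ` I" "a \<in> U ` I" using insert.prems by simp_all
    then obtain i j where i: "i \<in> I" "\<Union>\<F> \<subseteq> U i" and j: "j \<in> I" "a = U j"
      using insert.IH by (elim imageE) blast
    then obtain k where "k \<in> I" "U i \<union> U j \<subseteq> U k" using dir by blast
    then have "\<Union>(insert a \<F>) \<subseteq> U k" using i(2) j(2) by blast
    then show ?case using \<open>k \<in> I\<close> by blast
  qed
  then show ?thesis using \<F>(3) by blast
qed

section \<open>Rank one families with a common nonunit\<close>

text \<open>The element \<open>d\<close> plays the role of a pseudo-uniformizer shared by all members of the family.\<close>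

locale rank_one_family = ambient_field F for F (structure) +
  fixes X :: "'a set set" and d :: 'a
  assumes rank_one_member: "V \<in> X \<Longrightarrow> rank_one V"
    and nonempty: "X \<noteq> {}"
    and d_nonzero: "d \<noteq> \<zero>"
    and d_nonunit: "V \<in> X \<Longrightarrow> d \<in> nonunits V"
begin

abbreviation zariski_X :: "'a set topology" where
  "zariski_X \<equiv> subtopology (zariski_topology F) X"

lemma Zar_member: "V \<in> X \<Longrightarrow> V \<in> Zar F"
  using rank_one_member rank_oneD(1) by blast

lemma topspace_X: "topspace zariski_X = X"
  using Zar_member by (auto simp: topspace_zariski)

lemma d_carrier: "d \<in> carrier F"
  using nonempty d_nonunit Zar_member nonunitsD(1) Zar_closed(2) by blast

lemmas inv_d = inv_nonzero[OF d_carrier d_nonzero]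

lemma openin_X_member:
  assumes "t \<in> carrier F" shows "openin zariski_X {V \<in> X. t \<in> V}"
proof -
  have "{V \<in> X. t \<in> V} = {V \<in> Zar F. t \<in> V} \<inter> X" using Zar_member by blast
  then show ?thesis using openin_zariski_member[OF assms] unfolding openin_subtopology by blast
qed

text \<open>The quotients \<open>t\<^sup>n / d\<close> write \<open>v(t) > 0\<close>, the complement of the open condition \<open>1/t \<in> V\<close>, as a
  union of open conditions \<open>x \<in> V\<close>. Conversely, if \<open>1/t \<in> V\<close> then \<open>t\<^sup>n \<in> d V\<close> would make \<open>\<one>\<close> a nonunit.\<close>

lemma nonunit_iff:
  assumes V: "V \<in> X" and t: "t \<in> carrier F"
  shows "t \<in> nonunits V \<longleftrightarrow> (\<exists>n::nat. t [^] n \<otimes> inv d \<in> V)"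
proof
  assume "t \<in> nonunits V"
  then show "\<exists>n::nat. t [^] n \<otimes> inv d \<in> V"
    using rank_oneD(3)[OF rank_one_member[OF V] _ d_nonunit[OF V] d_nonzero] by blast
next
  note VZ = Zar_member[OF V]
  assume "\<exists>n::nat. t [^] n \<otimes> inv d \<in> V"
  then obtain n :: nat where "t [^] n \<otimes> inv d \<in> V" by blast
  then have "(t [^] n \<otimes> inv d) \<otimes> d \<in> nonunits V" by (rule nonunits_mult[OF VZ _ d_nonunit[OF V]])
  then have tn: "t [^] n \<in> nonunits V" using mult_inv_cancel(2)[OF _ d_carrier d_nonzero] t by simp
  show "t \<in> nonunits V"
  proof (rule ccontr)
    assume *: "t \<notin> nonunits V"
    have "t \<noteq> \<zero> \<and> inv t \<in> V"
    proof (cases "t \<in> V")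
      case True then show ?thesis using unit_inv[OF _ *] by blast
    next
      case False then show ?thesis using inv_in_nonunits[OF VZ t] nonunitsD(1) by blast
    qed
    then have t0: "t \<noteq> \<zero>" and it: "inv t \<in> V" by blast+
    note i = inv_nonzero[OF t t0]
    have "(inv t) [^] n \<otimes> t [^] n \<in> nonunits V"
      by (rule nonunits_mult[OF VZ pow_in_subring[OF Zar_closed(1)[OF VZ] it] tn])
    moreover have "(inv t) [^] n \<otimes> t [^] n = \<one>"
      using i t by (simp flip: nat_pow_distrib)
    ultimately show False using one_notin_nonunits[OF VZ] by simp
  qed
qed

lemma openin_X_nonunit:
  assumes t: "t \<in> carrier F" shows "openin zariski_X {V \<in> X. t \<in> nonunits V}"
proof -
  have "{V \<in> X. t \<in> nonunits V} = (\<Union>n. {V \<in> X. t [^] (n::nat) \<otimes> inv d \<in> V})"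
    using nonunit_iff[OF _ t] by blast
  moreover have "openin zariski_X {V \<in> X. t [^] n \<otimes> inv d \<in> V}" for n :: nat
    using t inv_d by (intro openin_X_member) simp
  ultimately show ?thesis by (simp only:) blast
qed

text \<open>Distinct members are incomparable, and \<open>t \<in> V - W\<close> separates them: \<open>t\<close> integral on one side,
  \<open>1/t\<close> a nonunit on the other, both open conditions.\<close>

lemma Hausdorff_X: "Hausdorff_space zariski_X"
  unfolding Hausdorff_space_def topspace_X
proof (intro allI impI)
  fix V W assume VW: "V \<in> X \<and> W \<in> X \<and> V \<noteq> W"
  note VZ = Zar_member[of V] and WZ = Zar_member[of W]
  have "\<not> V \<subseteq> W"
    using rank_one_maximal_subring[OF rank_one_member[of V] Zar_closed(1)[of W]] VW WZ
      rank_oneD(2)[OF rank_one_member[of W]] by blast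
  then obtain t where t: "t \<in> V" "t \<notin> W" by blast
  have tF: "t \<in> carrier F" using t Zar_closed(2) VZ VW by blast
  note i = inv_in_nonunits[OF WZ tF t(2)]
  have t0: "t \<noteq> \<zero>" using i VW by blast
  note it = inv_nonzero[OF tF t0]
  have "disjnt {V \<in> X. t \<in> V} {V \<in> X. inv t \<in> nonunits V}"
    unfolding disjnt_iff using nonunitsD(2)[of "inv t"] it by auto
  then show "\<exists>U U'. openin zariski_X U \<and> openin zariski_X U' \<and> V \<in> U \<and> W \<in> U' \<and> disjnt U U'"
    using openin_X_member[OF tF] openin_X_nonunit[OF it(1)] VW t i
    by (intro exI[of _ "{V \<in> X. t \<in> V}"] exI[of _ "{V \<in> X. inv t \<in> nonunits V}"]) simp
qed

end

locale compact_rank_one_family = rank_one_family +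
  assumes compact: "compact_space zariski_X"
begin

abbreviation A :: "'a set" where "A \<equiv> ring_of_valuations X"

lemma A_iff: "x \<in> A \<longleftrightarrow> x \<in> carrier F \<and> (\<forall>V\<in>X. x \<in> V)"
  using nonempty Zar_closed(2)[OF Zar_member] unfolding ring_of_valuations_def by blast

lemma A_subset: "V \<in> X \<Longrightarrow> A \<subseteq> V"
  unfolding ring_of_valuations_def by blast

lemma A_subring: "subring A F"
  unfolding ring_of_valuations_def
  using subring_Inter[of X] nonempty Zar_closed(1)[OF Zar_member] by simp

lemmas A_closed = subringE(2,3,5-7)[OF A_subring]

lemma A_carrier: "x \<in> A \<Longrightarrow> x \<in> carrier F"
  using A_iff by blast

text \<open>Where \<open>t\<close> is not integral, \<open>1/t\<close> is a nonunit, so \<open>(1/t)\<^sup>m / d\<close> becomes integral for large \<open>m\<close> and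
  stays so. The sets of \<open>V\<close> for which \<open>m\<close> suffices are open and increasing, and they cover \<open>X\<close>, hence
  one \<open>m\<close> suffices everywhere and \<open>c = d t\<^sup>m\<close> works.\<close>

lemma uniform_pole_bound:
  assumes t: "t \<in> carrier F" "t \<noteq> \<zero>"
  shows "\<exists>c\<in>carrier F. c \<noteq> \<zero> \<and> (\<forall>V\<in>X. (t \<in> V \<longrightarrow> c \<in> nonunits V) \<and> (t \<notin> V \<longrightarrow> inv c \<in> V))"
proof -
  note it = inv_nonzero[OF t]
  define c where "c m = d \<otimes> t [^] m" for m :: nat
  have cF: "c m \<in> carrier F" and c0: "c m \<noteq> \<zero>" and ic: "inv (c m) = inv d \<otimes> inv (t [^] m)" for m
    using inv_mult[OF d_carrier d_nonzero nat_pow_closed[OF t(1)] pow_nonzero[OF t]] d_carrier t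
    by (simp_all add: c_def)
  have itm: "inv (t [^] m) = (inv t) [^] m" for m :: nat
    by (rule comm_inv_char) (use t it in \<open>auto simp flip: nat_pow_distrib\<close>)
  define U where "U m = {V \<in> X. t \<in> V} \<union> {V \<in> X. inv (c m) \<in> V}" for m
  have step: "U m \<subseteq> U (Suc m)" for m
  proof
    fix V assume V: "V \<in> U m"
    show "V \<in> U (Suc m)"
    proof (cases "t \<in> V")
      case True
      then show ?thesis using V by (auto simp: U_def)
    next
      case False
      have VX: "V \<in> X" and "inv (c m) \<in> V" using V False by (auto simp: U_def)
      then have "inv (c m) \<otimes> inv t \<in> V"
        using Zar_closed(6)[OF Zar_member] inv_in_nonunits(2)[OF Zar_member t(1) False] nonunitsD(1) by blast
      moreover have "inv (c (Suc m)) = inv (c m) \<otimes> inv t"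
        unfolding ic itm using it inv_d by (simp add: m_assoc)
      ultimately show ?thesis using VX by (simp add: U_def)
    qed
  qed
  then have mono: "m \<le> n \<Longrightarrow> U m \<subseteq> U n" for m n by (rule lift_Suc_mono_le)
  have "\<exists>m\<in>UNIV. topspace zariski_X \<subseteq> U m"
  proof (rule compact_space_directed_cover[OF compact])
    show "openin zariski_X (U m)" for m
      unfolding U_def using t(1) inv_nonzero(1)[OF cF c0] by (intro openin_Un openin_X_member)
    show "\<exists>k\<in>UNIV. U i \<union> U j \<subseteq> U k" for i j
      using mono[of i "max i j"] mono[of j "max i j"] by (intro bexI[of _ "max i j"]) auto
    fix V assume "V \<in> topspace zariski_X"
    then have V: "V \<in> X" by (simp add: topspace_X)
    show "\<exists>m\<in>UNIV. V \<in> U m"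
    proof (cases "t \<in> V")
      case True
      then show ?thesis using V by (simp add: U_def)
    next
      case False
      then obtain m :: nat where "(inv t) [^] m \<otimes> inv d \<in> V"
        using nonunit_iff[OF V it(1)] inv_in_nonunits(2)[OF Zar_member[OF V] t(1)] by blast
      then have "inv (c m) \<in> V" unfolding ic itm using it inv_d by (simp add: m_comm)
      then show ?thesis using V by (auto simp: U_def)
    qed
  qed simp
  then obtain m where m: "X \<subseteq> U m" unfolding topspace_X by blast
  have "c m \<in> nonunits V" if V: "V \<in> X" "t \<in> V" for V
  proof -
    note VZ = Zar_member[OF V(1)]
    have "t [^] m \<otimes> d \<in> nonunits V"
      by (rule nonunits_mult[OF VZ pow_in_subring[OF Zar_closed(1)[OF VZ] V(2)] d_nonunit[OF V(1)]])
    then show ?thesis using t d_carrier by (simp add: c_def m_comm)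
  qed
  moreover have "inv (c m) \<in> V" if "V \<in> X" "t \<notin> V" for V using m that by (auto simp: U_def)
  ultimately show ?thesis using cF c0 by blast
qed

text \<open>With \<open>c\<close> as in \<open>uniform_pole_bound\<close>, the product \<open>w = ct\<close> is a nonunit where \<open>t\<close> is integral, and
  \<open>s = 1/w\<close> is a nonunit elsewhere. So \<open>x = 1/(1 + w) = s/(1 + s)\<close> and \<open>y = cx\<close> are integral at every
  \<open>V\<close>: use the first expression where \<open>1 + w\<close> is a unit and the second where \<open>1 + s\<close> is. The
  statement says that the fractional ideal generated by \<open>\<one>\<close> and \<open>t\<close> is invertible, and locates where
  each of its two generators is needed.\<close>

lemma separation:
  assumes t: "t \<in> carrier F"
  shows "\<exists>x\<in>A. \<exists>y\<in>A. x \<otimes> t \<in> A \<and> y \<otimes> t \<in> A \<and> x \<oplus> y \<otimes> t = \<one> \<and>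
    (\<forall>V\<in>X. (t \<in> V \<longrightarrow> y \<otimes> t \<in> nonunits V) \<and> (t \<notin> V \<longrightarrow> x \<in> nonunits V))"
proof (cases "t = \<zero>")
  case True
  \<comment> \<open>The zero element has no inverse to work with, but the pair \<open>\<one>, \<zero>\<close> serves.\<close>
  have "\<zero> \<in> nonunits V \<and> \<zero> \<in> V" if "V \<in> X" for V
    using Zar_closed(3)[OF Zar_member[OF that]] by (simp add: nonunits_def)
  then show ?thesis using True A_closed by (intro bexI[of _ \<one>] bexI[of _ \<zero>]) auto
next
  case False
  note it = inv_nonzero[OF t False]
  obtain c where c: "c \<in> carrier F" "c \<noteq> \<zero>"
    and cV: "\<And>V. V \<in> X \<Longrightarrow> t \<in> V \<Longrightarrow> c \<in> nonunits V"
    and icV: "\<And>V. V \<in> X \<Longrightarrow> t \<notin> V \<Longrightarrow> inv c \<in> V"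
    using uniform_pole_bound[OF t False] by blast
  note ic = inv_nonzero[OF c]
  define w where "w = c \<otimes> t"
  define x where "x = inv (\<one> \<oplus> w)"
  define y where "y = x \<otimes> c"
  have w: "w \<in> carrier F" "w \<noteq> \<zero>" and iw: "inv w = inv c \<otimes> inv t"
    using inv_mult[OF c t False] c t by (simp_all add: w_def)
  note iw' = inv_nonzero[OF w]
  have key: "\<one> \<oplus> w \<noteq> \<zero> \<and> x \<in> V \<and> x \<otimes> t \<in> V \<and> y \<in> V \<and> y \<otimes> t \<in> V \<and>
      (t \<in> V \<longrightarrow> y \<otimes> t \<in> nonunits V) \<and> (t \<notin> V \<longrightarrow> x \<in> nonunits V)" if V: "V \<in> X" for V
  proof (cases "t \<in> V")
    case True
    note VZ = Zar_member[OF V] and cn = cV[OF V True]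
    have "t \<otimes> c \<in> nonunits V" by (rule nonunits_mult[OF VZ True cn])
    then have wn: "w \<in> nonunits V" using c t by (simp add: w_def m_comm)
    have one: "\<one> \<oplus> w \<noteq> \<zero>" and xV: "x \<in> V" using unit_one_plus[OF VZ wn] by (simp_all add: x_def)
    have yn: "y \<in> nonunits V" unfolding y_def by (rule nonunits_mult[OF VZ xV cn])
    have "t \<otimes> y \<in> nonunits V" by (rule nonunits_mult[OF VZ True yn])
    moreover have "t \<otimes> y = y \<otimes> t"
      using t Zar_closed(2)[OF VZ nonunitsD(1)[OF yn]] by (simp add: m_comm)
    ultimately have ytn: "y \<otimes> t \<in> nonunits V" by simp
    show ?thesis
      using one xV True Zar_closed(6)[OF VZ xV True] nonunitsD(1)[OF yn] nonunitsD(1)[OF ytn] ytn by simp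
  next
    case False
    note VZ = Zar_member[OF V] and icn = icV[OF V False] and itn = inv_in_nonunits(2)[OF Zar_member[OF V] t False]
    define s where "s = inv w"
    have sn: "s \<in> nonunits V" unfolding s_def iw by (rule nonunits_mult[OF VZ icn itn])
    have s: "s \<in> carrier F" "s \<otimes> w = \<one>" "s \<noteq> \<zero>" using iw' by (simp_all add: s_def)
    define u where "u = inv (\<one> \<oplus> s)"
    have one: "\<one> \<oplus> s \<noteq> \<zero>" and uV: "u \<in> V" using unit_one_plus[OF VZ sn] by (simp_all add: u_def)
    have sF: "\<one> \<oplus> s \<in> carrier F" using s by simp
    have u: "u \<in> carrier F" "u \<otimes> (\<one> \<oplus> s) = \<one>" using inv_nonzero[OF sF one] by (simp_all add: u_def)
    \<comment> \<open>Pass from \<open>w\<close> to \<open>s = 1/w\<close>, since only \<open>1 + s\<close> is a unit at \<open>V\<close>.\<close>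
    have w1: "\<one> \<oplus> w = w \<otimes> (\<one> \<oplus> s)" using s w by (simp add: r_distr m_comm a_comm)
    then have one': "\<one> \<oplus> w \<noteq> \<zero>" using inv_mult(2)[OF w sF one] by simp
    have x: "x = u \<otimes> s" unfolding x_def w1 inv_mult(1)[OF w sF one]
      using u(1) s(1) by (simp add: s_def u_def m_comm)
    have xn: "x \<in> nonunits V" unfolding x by (rule nonunits_mult[OF VZ uV sn])
    have st: "s \<otimes> t = inv c" unfolding s_def iw by (rule mult_inv_cancel(2)[OF ic(1) t \<open>t \<noteq> \<zero>\<close>])
    have sc: "s \<otimes> c = inv t" unfolding s_def iw
      using mult_inv_cancel(2)[OF it(1) c] ic(1) it(1) by (simp add: m_comm)
    have xt: "x \<otimes> t = u \<otimes> inv c" unfolding x using u(1) s(1) t st by (simp add: m_assoc)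
    have y: "y = u \<otimes> inv t" unfolding y_def x using u(1) s(1) c(1) sc by (simp add: m_assoc)
    have yt: "y \<otimes> t = u" unfolding y by (rule mult_inv_cancel(2)[OF u(1) t \<open>t \<noteq> \<zero>\<close>])
    show ?thesis
      using one' xn nonunitsD(1)[OF xn] xt Zar_closed(6)[OF VZ uV icn]
        y Zar_closed(6)[OF VZ uV nonunitsD(1)[OF itn]] yt uV False by simp
  qed
  have one: "\<one> \<oplus> w \<noteq> \<zero>" using key nonempty by blast
  have xF: "x \<in> carrier F" and x1: "x \<otimes> (\<one> \<oplus> w) = \<one>"
    using inv_nonzero[OF _ one] w by (simp_all add: x_def)
  have yF: "y \<in> carrier F" using xF c by (simp add: y_def)
  have "x \<oplus> y \<otimes> t = x \<otimes> (\<one> \<oplus> w)"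
    using xF c t by (simp add: y_def w_def r_distr m_assoc)
  then have "x \<oplus> y \<otimes> t = \<one>" using x1 by simp
  moreover have "x \<in> A" "x \<otimes> t \<in> A" "y \<in> A" "y \<otimes> t \<in> A"
    unfolding A_iff using key xF yF t by auto
  ultimately show ?thesis using key by blast
qed

section \<open>The intersection of a compact rank one family\<close>

definition center :: "'a set \<Rightarrow> 'a set" where
  "center V = nonunits V \<inter> A"

lemma one_notin_center: "V \<in> X \<Longrightarrow> \<one> \<notin> center V"
  using one_notin_nonunits[OF Zar_member] by (simp add: center_def)

lemma center_ideal:
  assumes V: "V \<in> X" shows "ideal (center V) (F\<lparr>carrier := A\<rparr>)"
  unfolding ideal_iff[OF A_subring] center_def
proof (intro conjI ballI)
  note VZ = Zar_member[OF V]
  show "\<zero> \<in> nonunits V \<inter> A" using A_closed(1) Zar_closed(3)[OF VZ] by (simp add: nonunits_def)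
  show "x \<oplus> y \<in> nonunits V \<inter> A" if "x \<in> nonunits V \<inter> A" "y \<in> nonunits V \<inter> A" for x y
    using that nonunits_add[OF VZ, of x y] A_closed(5)[of x y] by simp
  show "a \<otimes> x \<in> nonunits V \<inter> A" if "a \<in> A" "x \<in> nonunits V \<inter> A" for a x
    using that nonunits_mult[OF VZ, of a x] A_closed(4)[of a x] A_subset[OF V] by auto
qed simp

lemma center_prime:
  assumes V: "V \<in> X" shows "primeideal (center V) (F\<lparr>carrier := A\<rparr>)"
  unfolding primeideal_iff[OF A_subring]
  using center_ideal[OF V] one_notin_center[OF V] nonunits_prime[OF Zar_member[OF V]] A_subset[OF V]
  by (auto simp: center_def)

text \<open>For \<open>a\<close> a unit of \<open>V\<close>, separation applied to \<open>t = 1/a\<close> gives \<open>x/a \<in> A\<close>, and \<open>1 - a (x/a) = y/a\<close> lies in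
  the center: \<open>x/a\<close> inverts \<open>a\<close> modulo the center.\<close>

lemma center_maximal:
  assumes V: "V \<in> X" shows "maximalideal (center V) (F\<lparr>carrier := A\<rparr>)"
  unfolding maximalideal_iff[OF A_subring]
proof (intro conjI ballI impI center_ideal[OF V] one_notin_center[OF V])
  note VZ = Zar_member[OF V]
  fix a assume a: "a \<in> A" "a \<notin> center V"
  have aV: "a \<in> V" "a \<notin> nonunits V" and aF: "a \<in> carrier F"
    using a A_subset[OF V] A_carrier by (auto simp: center_def)
  note u = unit_inv[OF aV] and ia = inv_nonzero[OF aF unit_inv(1)[OF aV]]
  obtain x y where xy: "x \<in> A" "y \<in> A" "x \<otimes> inv a \<in> A" "y \<otimes> inv a \<in> A" "x \<oplus> y \<otimes> inv a = \<one>"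
      "y \<otimes> inv a \<in> nonunits V"
    using separation[OF ia(1)] V u(2) by blast
  note c = A_carrier[OF xy(1)] A_carrier[OF xy(4)]
  have "a \<otimes> (x \<otimes> inv a) = x" using m_lcomm[of a x "inv a"] c aF ia by simp
  then have "\<one> \<ominus> a \<otimes> (x \<otimes> inv a) = (x \<oplus> y \<otimes> inv a) \<ominus> x" using xy(5) by simp
  also have "\<dots> = y \<otimes> inv a" using c by algebra
  finally show "\<exists>b\<in>A. \<one> \<ominus> a \<otimes> b \<in> center V" using xy by (intro bexI[of _ "x \<otimes> inv a"]) (auto simp: center_def)
qed

lemma zero_in_center: "V \<in> X \<Longrightarrow> \<zero> \<in> center V"
  using idealD(3)[OF A_subring center_ideal] .

text \<open>For \<open>t \<in> V\<close> the separating \<open>x\<close> is a unit at \<open>V\<close> and \<open>xt \<in> A\<close>, so \<open>t = (xt)/x\<close> is a fraction with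
  admissible denominator.\<close>

lemma localization_center:
  assumes V: "V \<in> X" shows "localization F A (center V) = V"
proof
  note VZ = Zar_member[OF V]
  show "localization F A (center V) \<subseteq> V"
    by (rule localization_subset_valuation_ring[OF A_subring zero_in_center[OF V] VZ A_subset[OF V]])
      (simp add: center_def)
  show "V \<subseteq> localization F A (center V)"
  proof
    fix t assume t: "t \<in> V"
    have tF: "t \<in> carrier F" using t by (rule Zar_closed(2)[OF VZ])
    obtain x y where xy: "x \<in> A" "x \<otimes> t \<in> A" "x \<oplus> y \<otimes> t = \<one>" "y \<otimes> t \<in> nonunits V"
      using separation[OF tF] V t by blast
    have "x \<notin> nonunits V"
      using nonunits_add[OF VZ _ xy(4), of x] xy(3) one_notin_nonunits[OF VZ] by auto
    then have "x \<in> A - center V" using xy(1) by (simp add: center_def)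
    then show "t \<in> localization F A (center V)"
      unfolding localization_iff[OF A_subring zero_in_center[OF V]] using tF xy(2) m_comm by blast
  qed
qed

text \<open>Otherwise the sets of \<open>V\<close> at which a given \<open>a \<in> I\<close> is a unit form an open cover of \<open>X\<close>. It is
  directed: for \<open>a, b \<in> I\<close>, separation applied to \<open>1/a\<close> gives \<open>x + z = 1\<close> in \<open>A\<close> with \<open>x\<close> a unit and
  \<open>z\<close> a nonunit exactly where \<open>a\<close> is a unit, so \<open>xa + zb\<close> is a unit wherever \<open>a\<close> or \<open>b\<close> is. By
  compactness some \<open>a \<in> I\<close> is a unit at every \<open>V\<close>, hence in \<open>A\<close>.\<close>

lemma proper_ideal_in_center:
  assumes I: "ideal I (F\<lparr>carrier := A\<rparr>)" and proper: "\<one> \<notin> I"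
  shows "\<exists>V\<in>X. I \<subseteq> center V"
proof (rule ccontr)
  note ID = idealD[OF A_subring I]
  assume no: "\<not> (\<exists>V\<in>X. I \<subseteq> center V)"
  define U where "U a = {V \<in> X. a \<notin> nonunits V}" for a
  have zero: "\<zero> \<in> nonunits V" if "V \<in> X" for V
    using Zar_closed(3)[OF Zar_member[OF that]] by (simp add: nonunits_def)
  have U_inv: "U a = {V \<in> X. inv a \<in> V}" if a: "a \<in> I" "a \<noteq> \<zero>" for a
  proof -
    have "a \<in> V" if "V \<in> X" for V using ID(1)[OF a(1)] A_subset[OF that] by blast
    then show ?thesis using a(2) unfolding U_def by (auto simp: nonunits_def)
  qed
  have "\<exists>a\<in>I. topspace zariski_X \<subseteq> U a"
  proof (rule compact_space_directed_cover[OF compact])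
    show "I \<noteq> {}" using ID(3) by blast
    show "openin zariski_X (U a)" if a: "a \<in> I" for a
    proof (cases "a = \<zero>")
      case True
      then have "U a = {}" using zero by (auto simp: U_def)
      then show ?thesis by simp
    next
      case False
      then show ?thesis
        using U_inv[OF a False] openin_X_member[OF inv_nonzero(1)[OF ID(2)[OF a] False]] by simp
    qed
    show "\<exists>a\<in>I. V \<in> U a" if "V \<in> topspace zariski_X" for V
      using that no ID(1) unfolding topspace_X U_def center_def by blast
    show "\<exists>c\<in>I. U a \<union> U b \<subseteq> U c" if a: "a \<in> I" and b: "b \<in> I" for a b
    proof (cases "a = \<zero>")
      case True
      then have "U a = {}" using zero by (auto simp: U_def)
      then show ?thesis using b by auto
    next
      case False
      note ia = inv_nonzero[OF ID(2)[OF a] False]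
      obtain x y where xy: "x \<in> A" "y \<otimes> inv a \<in> A" "x \<oplus> y \<otimes> inv a = \<one>"
        and sep: "\<And>V. V \<in> X \<Longrightarrow> inv a \<in> V \<Longrightarrow> y \<otimes> inv a \<in> nonunits V"
                 "\<And>V. V \<in> X \<Longrightarrow> inv a \<notin> V \<Longrightarrow> x \<in> nonunits V"
        using separation[OF ia(1)] by blast
      define z where "z = y \<otimes> inv a"
      have z: "z \<in> A" "x \<oplus> z = \<one>" using xy by (simp_all add: z_def)
      \<comment> \<open>A unit plus a nonunit at each \<open>V\<close> where \<open>a\<close> or \<open>b\<close> is a unit.\<close>
      define c where "c = x \<otimes> a \<oplus> z \<otimes> b"
      have cI: "c \<in> I" unfolding c_def by (intro ID(4) ID(5) a b xy(1) z(1))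
      have "V \<in> U c" if V: "V \<in> U a \<union> U b" for V
      proof -
        have VX: "V \<in> X" using V by (auto simp: U_def)
        note VZ = Zar_member[OF VX]
        have inV: "x \<in> V" "z \<in> V" "a \<in> V" "b \<in> V"
          using A_subset[OF VX] xy(1) z(1) ID(1)[OF a] ID(1)[OF b] by blast+
        note inF = inV[THEN Zar_closed(2)[OF VZ]]
        have "x \<otimes> a \<oplus> z \<otimes> b \<notin> nonunits V"
        proof (cases "inv a \<in> V")
          case True
          then have zn: "z \<in> nonunits V" using sep(1)[OF VX] by (simp add: z_def)
          have "x \<notin> nonunits V"
            using nonunits_add[OF VZ _ zn, of x] z(2) one_notin_nonunits[OF VZ] by auto
          moreover have "a \<notin> nonunits V" using True nonunitsD(2) False by blast
          ultimately have "x \<otimes> a \<notin> nonunits V" using nonunits_prime[OF VZ inV(1,3)] by blast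
          moreover have "z \<otimes> b \<in> nonunits V"
            using nonunits_mult[OF VZ inV(4) zn] inF by (simp add: m_comm)
          ultimately show ?thesis
            by (rule unit_plus_nonunit[OF VZ Zar_closed(6)[OF VZ inV(1,3)]])
        next
          case False
          then have xn: "x \<in> nonunits V" using sep(2)[OF VX] by blast
          have "z \<notin> nonunits V"
            using nonunits_add[OF VZ xn, of z] z(2) one_notin_nonunits[OF VZ] by auto
          moreover have "V \<notin> U a" using U_inv[OF a \<open>a \<noteq> \<zero>\<close>] False by blast
          then have "b \<notin> nonunits V" using V by (auto simp: U_def)
          ultimately have "z \<otimes> b \<notin> nonunits V" using nonunits_prime[OF VZ inV(2,4)] by blast
          moreover have "x \<otimes> a \<in> nonunits V"
            using nonunits_mult[OF VZ inV(3) xn] inF by (simp add: m_comm)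
          ultimately have "z \<otimes> b \<oplus> x \<otimes> a \<notin> nonunits V"
            by (rule unit_plus_nonunit[OF VZ Zar_closed(6)[OF VZ inV(2,4)]])
          then show ?thesis using inF by (simp add: a_comm)
        qed
        then show ?thesis using VX by (simp add: U_def c_def)
      qed
      then show ?thesis using cI by blast
    qed
  qed
  then obtain a where a: "a \<in> I" "X \<subseteq> U a" unfolding topspace_X by blast
  have a0: "a \<noteq> \<zero>" using a(2) zero nonempty by (auto simp: U_def)
  note ia = inv_nonzero[OF ID(2)[OF a(1)] a0]
  have "inv a \<in> A" unfolding A_iff using U_inv[OF a(1) a0] a(2) ia(1) by blast
  then have "inv a \<otimes> a \<in> I" using ID(5) a(1) by blast
  then show False using ia proper by simp
qed

lemma max_ideals_A: "max_ideals F A = center ` X"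
proof
  show "center ` X \<subseteq> max_ideals F A" using center_maximal by (auto simp: max_ideals_def)
  show "max_ideals F A \<subseteq> center ` X"
  proof
    fix M assume "M \<in> max_ideals F A"
    then have M: "maximalideal M (F\<lparr>carrier := A\<rparr>)" by (simp add: max_ideals_def)
    then have "ideal M (F\<lparr>carrier := A\<rparr>)" "\<one> \<notin> M" unfolding maximalideal_iff[OF A_subring] by blast+
    then obtain V where V: "V \<in> X" "M \<subseteq> center V" using proper_ideal_in_center by blast
    have "center V = M \<or> center V = A"
      using maximalideal.I_maximal[OF M center_ideal[OF V(1)] V(2)] by (simp add: center_def)
    then have "center V = M" using one_notin_center[OF V(1)] A_closed(2) by blast
    then show "M \<in> center ` X" using V(1) by blast
  qed
qed

lemma localizations_at_max_A: "localizations_at_max F A = X"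
proof -
  have "localizations_at_max F A = (\<lambda>V. localization F A (center V)) ` X"
    unfolding localizations_at_max_def max_ideals_A by blast
  also have "\<dots> = X" using localization_center by simp
  finally show ?thesis .
qed

text \<open>Let \<open>\<zero> \<noteq> p \<in> P\<close> and \<open>P\<close> be inside the center of \<open>V\<close>. For \<open>m\<close> in the center the archimedean property
  gives \<open>m\<^sup>n / p \<in> V = A\<^sub>M\<close>, so \<open>s m\<^sup>n \<in> P\<close> with \<open>s\<close> outside the center and hence outside \<open>P\<close>; as \<open>P\<close> is
  prime, \<open>m \<in> P\<close>.\<close>

lemma nonzero_prime_is_center:
  assumes P: "primeideal P (F\<lparr>carrier := A\<rparr>)" and p: "p \<in> P" "p \<noteq> \<zero>"
  shows "\<exists>V\<in>X. P = center V"
proof -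
  have iP: "ideal P (F\<lparr>carrier := A\<rparr>)" and one: "\<one> \<notin> P"
    and prime: "x \<in> A \<Longrightarrow> y \<in> A \<Longrightarrow> x \<otimes> y \<in> P \<Longrightarrow> x \<in> P \<or> y \<in> P" for x y
    using P unfolding primeideal_iff[OF A_subring] by blast+
  note ID = idealD[OF A_subring iP]
  obtain V where V: "V \<in> X" "P \<subseteq> center V" using proper_ideal_in_center[OF iP one] by blast
  note VZ = Zar_member[OF V(1)]
  have "m \<in> P" if m: "m \<in> center V" for m
  proof -
    have mA: "m \<in> A" and mn: "m \<in> nonunits V" and pn: "p \<in> nonunits V"
      using m V(2) p(1) by (auto simp: center_def)
    have mF: "m \<in> carrier F" and pF: "p \<in> carrier F" using A_carrier mA ID(1) p(1) by blast+
    obtain n :: nat where n: "m [^] n \<otimes> inv p \<in> V"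
      using rank_oneD(3)[OF rank_one_member[OF V(1)] mn pn p(2)] by blast
    then have "m [^] n \<otimes> inv p \<in> localization F A (center V)" using localization_center[OF V(1)] by simp
    then obtain s where s: "s \<in> A - center V" "s \<otimes> (m [^] n \<otimes> inv p) \<in> A"
      unfolding localization_iff[OF A_subring zero_in_center[OF V(1)]] by blast
    have sF: "s \<in> carrier F" using s A_carrier by blast
    have "s \<otimes> (m [^] n \<otimes> inv p) \<otimes> p = s \<otimes> m [^] n"
      using sF mF pF inv_nonzero[OF pF p(2)] by (simp add: m_assoc)
    then have "s \<otimes> m [^] n \<in> P" using ID(5)[OF s(2) p(1)] by simp
    then have "m [^] n \<in> P" using prime[of s] pow_in_subring[OF A_subring mA] s(1) V(2) by blast
    then show "m \<in> P"
    proof (induction n)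
      case 0
      then show ?case using one by simp
    next
      case (Suc n)
      then show ?case using prime[of "m [^] n" m] pow_in_subring[OF A_subring mA] mA by auto
    qed
  qed
  then show ?thesis using V by blast
qed

lemma d_in_center: "V \<in> X \<Longrightarrow> d \<in> center V"
  unfolding center_def using d_nonunit d_carrier nonunitsD(1) A_iff by blast

lemma krull_dim_A: "krull_dim (F\<lparr>carrier := A\<rparr>) = 1"
  unfolding krull_dim_eq_1_iff
proof (intro conjI notI)
  obtain V where V: "V \<in> X" using nonempty by blast
  have "{\<zero>} \<subset> center V" using zero_in_center[OF V] d_in_center[OF V] d_nonzero by blast
  then show "\<exists>P Q. primeideal P (F\<lparr>carrier := A\<rparr>) \<and> primeideal Q (F\<lparr>carrier := A\<rparr>) \<and> P \<subset> Q"
    using zero_prime[OF A_subring] center_prime[OF V] by blast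
next
  assume "\<exists>P Q S. primeideal P (F\<lparr>carrier := A\<rparr>) \<and> primeideal Q (F\<lparr>carrier := A\<rparr>) \<and>
    primeideal S (F\<lparr>carrier := A\<rparr>) \<and> P \<subset> Q \<and> Q \<subset> S"
  then obtain P Q S where PQS: "primeideal P (F\<lparr>carrier := A\<rparr>)" "primeideal Q (F\<lparr>carrier := A\<rparr>)"
    "primeideal S (F\<lparr>carrier := A\<rparr>)" "P \<subset> Q" "Q \<subset> S" by blast
  obtain q where q: "q \<in> Q" "q \<notin> P" using PQS(4) by blast
  have iP: "ideal P (F\<lparr>carrier := A\<rparr>)" and iS: "ideal S (F\<lparr>carrier := A\<rparr>)" and one: "\<one> \<notin> S"
    using PQS(1,3) unfolding primeideal_iff[OF A_subring] by blast+
  have "q \<noteq> \<zero>" using q(2) idealD(3)[OF A_subring iP] by blast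
  then obtain V where V: "V \<in> X" "Q = center V" using nonzero_prime_is_center[OF PQS(2) q(1)] by blast
  have "S = Q \<or> S = A"
    using maximalideal.I_maximal[OF center_maximal[OF V(1)] iS] PQS(5) V(2) idealD(1)[OF A_subring iS]
    by auto
  then show False using PQS(5) one A_closed(2) by blast
qed

lemma jacobson_radical_A: "jacobson_radical (F\<lparr>carrier := A\<rparr>) \<noteq> {\<zero>}"
proof -
  have "{M. maximalideal M (F\<lparr>carrier := A\<rparr>)} = center ` X" using max_ideals_A by (simp add: max_ideals_def)
  then have "d \<in> jacobson_radical (F\<lparr>carrier := A\<rparr>)"
    unfolding jacobson_radical_def using d_in_center nonempty by (auto simp: center_def)
  then show ?thesis using d_nonzero by blast
qed

lemma A_in_prufer_overrings:
  assumes "\<And>V. V \<in> X \<Longrightarrow> R \<subseteq> V" and "quotient_field F R = carrier F"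
  shows "A \<in> one_dim_prufer_overrings_jac F R"
proof -
  have RA: "R \<subseteq> A" using assms(1) unfolding ring_of_valuations_def by blast
  have "valuation_domain F (localization F A M)" if M: "M \<in> max_ideals F A" for M
  proof -
    obtain V where V: "V \<in> X" "M = center V" using M unfolding max_ideals_A by blast
    then have "quotient_field F V = carrier F"
      using quotient_field_overring[OF Zar_closed(1)[OF Zar_member]] assms by blast
    then show ?thesis
      using V localization_center Zar_member by (simp add: valuation_domain_iff)
  qed
  then have "prufer_domain F A" unfolding prufer_domain_def using subdomainI'[OF A_subring] by blast
  moreover have "A \<in> overrings F R"
    unfolding overrings_def using A_subring RA subringE(1)[OF A_subring] assms(2) by simp
  ultimately show ?thesis
    unfolding one_dim_prufer_overrings_jac_def using krull_dim_A jacobson_radical_A by blast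
qed

end

section \<open>From Hausdorff families to a common nonunit\<close>

context ambient_field
begin

text \<open>Any two distinct points have disjoint basic neighbourhoods, given by finite sets \<open>S\<close> and \<open>S'\<close>. Let \<open>b \<in> R\<close> be a
  common denominator of \<open>S \<union> S'\<close>. A member of \<open>X\<close> in which \<open>b\<close> were a unit would contain \<open>S \<union> S'\<close> and
  so lie in both neighbourhoods. In a singleton \<open>X\<close> any nonzero nonunit will do.\<close>

lemma common_nonunit_if_Hausdorff:
  assumes R: "subring R F" "quotient_field F R = carrier F"
    and X: "X \<noteq> {}" "\<And>V. V \<in> X \<Longrightarrow> rank_one V" "\<And>V. V \<in> X \<Longrightarrow> R \<subseteq> V"
    and H: "Hausdorff_space (subtopology (zariski_topology F) X)"
  shows "\<exists>d. d \<noteq> \<zero> \<and> (\<forall>V\<in>X. d \<in> nonunits V)"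
proof (cases "\<exists>V W. V \<in> X \<and> W \<in> X \<and> V \<noteq> W")
  case True
  then obtain V W where VW: "V \<in> X" "W \<in> X" "V \<noteq> W" by blast
  have XZ: "X \<subseteq> Zar F" using X(2) rank_oneD(1) by blast
  have "topspace (subtopology (zariski_topology F) X) = X" using XZ by (auto simp: topspace_zariski)
  then obtain U U' where U: "openin (subtopology (zariski_topology F) X) U" "V \<in> U"
      "openin (subtopology (zariski_topology F) X) U'" "W \<in> U'" "disjnt U U'"
    using H VW unfolding Hausdorff_space_def by metis
  obtain T T' where T: "openin (zariski_topology F) T" "U = T \<inter> X"
      "openin (zariski_topology F) T'" "U' = T' \<inter> X"
    using U(1,3) unfolding openin_subtopology by blast
  obtain S where S: "finite S" "S \<subseteq> V" "{Y \<in> Zar F. S \<subseteq> Y} \<subseteq> T"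
    using zariski_basic_nbhd[OF T(1), of V] U(2) T(2) by blast
  obtain S' where S': "finite S'" "S' \<subseteq> W" "{Y \<in> Zar F. S' \<subseteq> Y} \<subseteq> T'"
    using zariski_basic_nbhd[OF T(3), of W] U(4) T(4) by blast
  have SF: "S \<union> S' \<subseteq> carrier F" using S(2) S'(2) Zar_closed(2) VW XZ by blast
  \<comment> \<open>Both are the set of quotients by nonzero elements of \<open>R\<close>.\<close>
  have "carrier F = localization F R {\<zero>}"
    using R(2) by (simp add: quotient_field_def localization_def)
  then obtain b where b: "b \<in> R - {\<zero>}" "\<And>x. x \<in> S \<union> S' \<Longrightarrow> b \<otimes> x \<in> R"
    using localization_common_denominator[OF R(1) zero_prime[OF R(1)], of "S \<union> S'"] S(1) S'(1) SF
    by auto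
  have "b \<in> nonunits Y" if Y: "Y \<in> X" for Y
  proof (rule ccontr)
    assume bn: "b \<notin> nonunits Y"
    have YZ: "Y \<in> Zar F" using XZ Y by blast
    have bY: "b \<in> Y" using b(1) X(3)[OF Y] by blast
    note u = unit_inv[OF bY bn] and bF = Zar_closed(2)[OF YZ bY]
    have "x \<in> Y" if x: "x \<in> S \<union> S'" for x
    proof -
      have "inv b \<otimes> (b \<otimes> x) \<in> Y" using Zar_closed(6)[OF YZ u(2)] b(2)[OF x] X(3)[OF Y] by blast
      moreover have "inv b \<otimes> (b \<otimes> x) = x"
        using inv_nonzero[OF bF u(1)] bF x SF by (auto simp flip: m_assoc)
      ultimately show ?thesis by simp
    qed
    then have "Y \<in> U" "Y \<in> U'" using S(3) S'(3) T(2,4) YZ Y by blast+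
    then show False using U(5) by (auto simp: disjnt_iff)
  qed
  then show ?thesis using b(1) by blast
next
  case False
  then obtain V where V: "X = {V}" using X(1) by blast
  then have "rank_one V" using X(2)[of V] by simp
  then obtain d where "d \<in> nonunits V" "d \<noteq> \<zero>" by (rule rank_one_nonunit)
  then show ?thesis unfolding V by (intro exI[of _ d]) simp
qed

section \<open>Localizations of one-dimensional Pruefer domains\<close>

text \<open>The denominators \<open>a \<in> A\<close> with \<open>a x \<in> A\<close> form an ideal, and it lies in no maximal ideal when \<open>x\<close> is in
  every localization.\<close>

lemma Inter_localizations_at_max:
  assumes A: "subring A F"
  shows "ring_of_valuations (localizations_at_max F A) = A"
proof
  show "A \<subseteq> ring_of_valuations (localizations_at_max F A)"
    unfolding ring_of_valuations_def localizations_at_max_def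
    using localization_overring(2)[OF A max_ideal_prime[OF A]] by blast
next
  note A' = subringE[OF A]
  show "ring_of_valuations (localizations_at_max F A) \<subseteq> A"
  proof
    fix x assume "x \<in> ring_of_valuations (localizations_at_max F A)"
    then have x: "x \<in> localization F A M" if "M \<in> max_ideals F A" for M
      using that unfolding ring_of_valuations_def localizations_at_max_def by blast
    have loc: "y \<in> localization F A M \<longleftrightarrow> y \<in> carrier F \<and> (\<exists>s\<in>A - M. s \<otimes> y \<in> A)"
      if "M \<in> max_ideals F A" for M y
      by (rule localization_iff[OF A zero_in_max_ideal[OF A that]])
    obtain M0 where "M0 \<in> max_ideals F A"
    proof (rule max_ideal_above[OF A])
      show "ideal {\<zero>} (F\<lparr>carrier := A\<rparr>)" "\<one> \<notin> {\<zero>}"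
        using zero_prime[OF A] unfolding primeideal_iff[OF A] by blast+
    qed
    then have xF: "x \<in> carrier F" using x loc by blast
    define I where "I = {a \<in> A. a \<otimes> x \<in> A}"
    have I: "ideal I (F\<lparr>carrier := A\<rparr>)" unfolding ideal_iff[OF A]
    proof (intro conjI ballI)
      show "I \<subseteq> A" by (auto simp: I_def)
      show "\<zero> \<in> I" using A'(2) xF by (simp add: I_def)
      show "a \<oplus> b \<in> I" if "a \<in> I" "b \<in> I" for a b
        using that A'(7)[of a b] A'(7)[of "a \<otimes> x" "b \<otimes> x"] A'(1) xF
        by (auto simp: I_def l_distr subset_eq)
      show "a \<otimes> b \<in> I" if "a \<in> A" "b \<in> I" for a b
        using that A'(6)[of a b] A'(6)[of a "b \<otimes> x"] A'(1) xF
        by (auto simp: I_def m_assoc subset_eq)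
    qed
    have "\<one> \<in> I"
    proof (rule ccontr)
      assume "\<one> \<notin> I"
      then obtain M where M: "M \<in> max_ideals F A" "I \<subseteq> M" by (rule max_ideal_above[OF A I])
      then show False using x[OF M(1)] unfolding loc[OF M(1)] by (auto simp: I_def)
    qed
    then show "x \<in> A" using xF by (simp add: I_def)
  qed
qed

text \<open>Given an open cover, the \<open>a \<in> A\<close> for which finitely many members cover all \<open>A\<^sub>M\<close> with \<open>a \<notin> M\<close> form an
  ideal. Each \<open>A\<^sub>M\<close> has a neighbourhood of this kind, so the ideal lies in no maximal ideal and contains
  \<open>\<one>\<close>.\<close>

lemma compact_localizations_at_max:
  assumes A: "subring A F" and Z: "localizations_at_max F A \<subseteq> Zar F"
  shows "compact_space (subtopology (zariski_topology F) (localizations_at_max F A))"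
proof -
  define X where "X = localizations_at_max F A"
  note A' = subringE[OF A]
  have top: "topspace (subtopology (zariski_topology F) X) = X"
    using Z by (auto simp: X_def topspace_zariski)
  have XI: "localization F A M \<in> X" if "M \<in> max_ideals F A" for M
    using that by (auto simp: X_def localizations_at_max_def)
  have "\<exists>\<F>. finite \<F> \<and> \<F> \<subseteq> \<U> \<and> X \<subseteq> \<Union>\<F>"
    if op: "\<forall>U\<in>\<U>. openin (subtopology (zariski_topology F) X) U" and cov: "X \<subseteq> \<Union>\<U>" for \<U>
  proof -
    define I where "I = {a \<in> A. \<exists>\<F>. finite \<F> \<and> \<F> \<subseteq> \<U> \<and>
      (\<forall>M\<in>max_ideals F A. a \<notin> M \<longrightarrow> localization F A M \<in> \<Union>\<F>)}"
    note maxD = max_ideal_ideal[OF A]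
    have I: "ideal I (F\<lparr>carrier := A\<rparr>)" unfolding ideal_iff[OF A]
    proof (intro conjI ballI)
      show "I \<subseteq> A" by (auto simp: I_def)
      show "\<zero> \<in> I" using A'(2) zero_in_max_ideal[OF A]
        unfolding I_def mem_Collect_eq by (intro conjI exI[of _ "{}"]) auto
    next
      fix a b assume a: "a \<in> I" and b: "b \<in> I"
      obtain \<F> where F: "a \<in> A" "finite \<F>" "\<F> \<subseteq> \<U>"
        "\<forall>M\<in>max_ideals F A. a \<notin> M \<longrightarrow> localization F A M \<in> \<Union>\<F>"
        using a unfolding I_def mem_Collect_eq by (elim conjE exE)
      obtain \<G> where G: "b \<in> A" "finite \<G>" "\<G> \<subseteq> \<U>"
        "\<forall>M\<in>max_ideals F A. b \<notin> M \<longrightarrow> localization F A M \<in> \<Union>\<G>"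
        using b unfolding I_def mem_Collect_eq by (elim conjE exE)
      have "localization F A M \<in> \<Union>(\<F> \<union> \<G>)" if M: "M \<in> max_ideals F A" "a \<oplus> b \<notin> M" for M
      proof -
        have "a \<notin> M \<or> b \<notin> M" using idealD(4)[OF A maxD(1)[OF M(1)]] M(2) by blast
        then show ?thesis using F(4) G(4) M(1) by blast
      qed
      then show "a \<oplus> b \<in> I"
        unfolding I_def mem_Collect_eq using F(1-3) G(1-3) A'(7)
        by (intro conjI exI[of _ "\<F> \<union> \<G>"]) simp_all
    next
      fix r a assume r: "r \<in> A" "a \<in> I"
      then obtain \<F> where F: "a \<in> A" "finite \<F>" "\<F> \<subseteq> \<U>"
        "\<forall>M\<in>max_ideals F A. a \<notin> M \<longrightarrow> localization F A M \<in> \<Union>\<F>"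
        unfolding I_def mem_Collect_eq by (elim conjE exE)
      have "localization F A M \<in> \<Union>\<F>" if M: "M \<in> max_ideals F A" "r \<otimes> a \<notin> M" for M
        using idealD(5)[OF A maxD(1)[OF M(1)] r(1)] M F(4) by blast
      then show "r \<otimes> a \<in> I"
        unfolding I_def mem_Collect_eq using F(1-3) r(1) A'(6) by (intro conjI exI[of _ \<F>]) simp_all
    qed
    have "\<one> \<in> I"
    proof (rule ccontr)
      assume "\<one> \<notin> I"
      then obtain M where M: "M \<in> max_ideals F A" "I \<subseteq> M" by (rule max_ideal_above[OF A I])
      obtain U where U: "U \<in> \<U>" "localization F A M \<in> U" using cov XI[OF M(1)] by blast
      obtain T where T: "openin (zariski_topology F) T" "U = T \<inter> X"
        using op U(1) unfolding openin_subtopology by blast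
      obtain S where S: "finite S" "S \<subseteq> localization F A M" "{W \<in> Zar F. S \<subseteq> W} \<subseteq> T"
        using zariski_basic_nbhd[OF T(1), of "localization F A M"] U(2) T(2) by blast
      note loc = localization_iff[OF A zero_in_max_ideal[OF A]]
      have SF: "S \<subseteq> carrier F" using S(2) loc[OF M(1)] by blast
      obtain s where s: "s \<in> A - M" "\<forall>x\<in>S. s \<otimes> x \<in> A"
        using localization_common_denominator[OF A max_ideal_prime[OF A M(1)] S(1,2)] by (elim bexE)
      have "localization F A N \<in> \<Union>{U}" if N: "N \<in> max_ideals F A" "s \<notin> N" for N
      proof -
        have "S \<subseteq> localization F A N" using loc[OF N(1)] SF s N(2) by blast
        moreover have "localization F A N \<in> Zar F" using XI[OF N(1)] Z by (auto simp: X_def)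
        ultimately show ?thesis using S(3) T(2) XI[OF N(1)] by blast
      qed
      then have "s \<in> I" unfolding I_def mem_Collect_eq using s(1) U(1) by (intro conjI exI[of _ "{U}"]) simp_all
      then show False using M(2) s(1) by blast
    qed
    then obtain \<F> where F: "finite \<F>" "\<F> \<subseteq> \<U>"
      "\<forall>M\<in>max_ideals F A. \<one> \<notin> M \<longrightarrow> localization F A M \<in> \<Union>\<F>"
      unfolding I_def mem_Collect_eq by (elim conjE exE)
    have "X \<subseteq> \<Union>\<F>" using F(3) maxD(2) unfolding X_def localizations_at_max_def by blast
    then show ?thesis using F(1,2) by blast
  qed
  then show ?thesis unfolding compact_space_alt X_def[symmetric] top by blast
qed

text \<open>The rank of \<open>A\<^sub>M\<close> is at most one because a chain of primes contracts to a chain in \<open>A\<close>, and at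
  least one because a nonzero element \<open>d\<close> of the Jacobson radical is a nonunit of every \<open>A\<^sub>M\<close>. The same
  \<open>d\<close> gives the Hausdorff property.\<close>

lemma localizations_at_max_in_compact_sets:
  assumes q: "quotient_field F R = carrier F" and A: "A \<in> one_dim_prufer_overrings_jac F R"
  shows "localizations_at_max F A \<in> compact_rank_one_sets F R"
proof -
  have sA: "subring A F" and RA: "R \<subseteq> A" and pr: "prufer_domain F A"
    and dim: "krull_dim (F\<lparr>carrier := A\<rparr>) = 1" and jac: "jacobson_radical (F\<lparr>carrier := A\<rparr>) \<noteq> {\<zero>}"
    using A by (auto simp: one_dim_prufer_overrings_jac_def overrings_def)
  define X where "X = localizations_at_max F A"
  have "\<zero> \<in> jacobson_radical (F\<lparr>carrier := A\<rparr>)"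
    using subringE(2)[OF sA] zero_in_max_ideal[OF sA] by (auto simp: jacobson_radical_def max_ideals_def)
  then have "jacobson_radical (F\<lparr>carrier := A\<rparr>) - {\<zero>} \<noteq> {}"
    using jac by (auto simp: subset_singleton_iff)
  then obtain d where "d \<in> jacobson_radical (F\<lparr>carrier := A\<rparr>) - {\<zero>}" by (rule ex_in_conv[THEN iffD2, THEN exE])
  then have d: "d \<in> jacobson_radical (F\<lparr>carrier := A\<rparr>)" "d \<noteq> \<zero>" by simp_all
  have dM: "d \<in> M" if "M \<in> max_ideals F A" for M
    using d(1) that unfolding jacobson_radical_def max_ideals_def by (elim IntE InterD)
  have L: "localization F A M \<in> overrings F R \<and> localization F A M \<in> Zar F \<and>
      krull_dim (F\<lparr>carrier := localization F A M\<rparr>) = 1 \<and> d \<in> nonunits (localization F A M)"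
    if M: "M \<in> max_ideals F A" for M
  proof -
    define V where "V = localization F A M"
    note Mp = max_ideal_prime[OF sA M]
    have sV: "subring V F" "A \<subseteq> V" using localization_overring[OF sA Mp] by (simp_all add: V_def)
    have RV: "R \<subseteq> V" using RA sV(2) by blast
    have VZ: "V \<in> Zar F"
      using pr M valuation_domain_iff[OF quotient_field_overring[OF sV(1) RV q]]
      by (simp add: prufer_domain_def V_def)
    have ov: "V \<in> overrings F R"
      using sV(1) RV subringE(1)[OF sV(1)] q by (simp add: overrings_def)
    have dn: "d \<in> nonunits V" using nonunits_localization[OF sA Mp] dM[OF M] by (auto simp: V_def)
    have "krull_dim (F\<lparr>carrier := V\<rparr>) = 1" unfolding krull_dim_eq_1_iff
    proof (intro conjI notI)
      have "{\<zero>} \<subset> nonunits V"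
        using dn d(2) Zar_closed(3)[OF VZ] by (auto simp: nonunits_def)
      then show "\<exists>P Q. primeideal P (F\<lparr>carrier := V\<rparr>) \<and> primeideal Q (F\<lparr>carrier := V\<rparr>) \<and> P \<subset> Q"
        using zero_prime[OF sV(1)] nonunits_primeideal[OF VZ] by blast
    next
      assume "\<exists>P Q S. primeideal P (F\<lparr>carrier := V\<rparr>) \<and> primeideal Q (F\<lparr>carrier := V\<rparr>) \<and>
        primeideal S (F\<lparr>carrier := V\<rparr>) \<and> P \<subset> Q \<and> Q \<subset> S"
      then obtain P Q S where PQS: "primeideal P (F\<lparr>carrier := V\<rparr>)" "primeideal Q (F\<lparr>carrier := V\<rparr>)"
        "primeideal S (F\<lparr>carrier := V\<rparr>)" "P \<subset> Q" "Q \<subset> S" by blast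
      note id = PQS(1-3)[unfolded primeideal_iff[OF sV(1)], THEN conjunct1]
      have "P \<inter> A \<subset> Q \<inter> A" "Q \<inter> A \<subset> S \<inter> A"
        using contraction_strict_mono[OF sA Mp] id PQS(4,5) by (simp_all add: V_def)
      then show False
        by (rule krull_dim_1_no_chain[OF dim PQS(1-3)[THEN contraction_prime[OF sA sV]]])
    qed
    then show ?thesis using ov VZ dn by (simp add: V_def)
  qed
  have XL: "\<exists>M\<in>max_ideals F A. V = localization F A M" if "V \<in> X" for V
    using that by (auto simp: X_def localizations_at_max_def)
  have XZ: "X \<subseteq> Zar F" using XL L by blast
  have Xne: "X \<noteq> {}"
  proof -
    have "ideal {\<zero>} (F\<lparr>carrier := A\<rparr>)" "\<one> \<notin> {\<zero>}"
      using zero_prime[OF sA] unfolding primeideal_iff[OF sA] by blast+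
    then obtain M where "M \<in> max_ideals F A" by (rule max_ideal_above[OF sA])
    then show ?thesis by (auto simp: X_def localizations_at_max_def)
  qed
  interpret rank_one_family F X d
  proof
    show "rank_one V" if "V \<in> X" for V using XL[OF that] L rank_one_if_krull_dim_1 by blast
    show "d \<in> nonunits V" if "V \<in> X" for V using XL[OF that] L by blast
  qed (fact Xne d(2))+
  have "zariski_compact F X"
    unfolding zariski_compact_def
    using XZ compact_localizations_at_max[OF sA] Hausdorff_X by (simp add: X_def)
  moreover have "X \<subseteq> rank_one_valuation_overrings F R"
    unfolding rank_one_valuation_overrings_def using XL L by blast
  ultimately show ?thesis unfolding compact_rank_one_sets_def using Xne by (simp add: X_def)
qed

lemma intersection_of_compact_rank_one_set:
  assumes R: "subring R F" "quotient_field F R = carrier F" and X: "X \<in> compact_rank_one_sets F R"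
  shows "ring_of_valuations X \<in> one_dim_prufer_overrings_jac F R"
    "localizations_at_max F (ring_of_valuations X) = X"
proof -
  have ne: "X \<noteq> {}" and sub: "X \<subseteq> rank_one_valuation_overrings F R" and zc: "zariski_compact F X"
    using X by (auto simp: compact_rank_one_sets_def)
  have r1: "rank_one V" and RV: "R \<subseteq> V" if "V \<in> X" for V
    using sub that rank_one_if_krull_dim_1
    by (auto simp: rank_one_valuation_overrings_def overrings_def)
  obtain d where d: "d \<noteq> \<zero>" "\<And>V. V \<in> X \<Longrightarrow> d \<in> nonunits V"
    using common_nonunit_if_Hausdorff[OF R ne r1 RV] zc unfolding zariski_compact_def by blast
  interpret compact_rank_one_family F X d
    using ne r1 d zc by unfold_locales (auto simp: zariski_compact_def)
  show "ring_of_valuations X \<in> one_dim_prufer_overrings_jac F R"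
    by (rule A_in_prufer_overrings[OF RV R(2)])
  show "localizations_at_max F (ring_of_valuations X) = X" by (rule localizations_at_max_A)
qed

end

section \<open>The correspondence\<close>

theorem corollary5p9:
  fixes F :: "('a, 'b) ring_scheme" and R :: "'a set"
  assumes "field F"
    and "subring R F"
    and "R \<noteq> carrier F"
    and "quotient_field F R = carrier F"
  shows "bij_betw ring_of_valuations (compact_rank_one_sets F R) (one_dim_prufer_overrings_jac F R) \<and>
         bij_betw (localizations_at_max F) (one_dim_prufer_overrings_jac F R) (compact_rank_one_sets F R) \<and>
         (\<forall>X \<in> compact_rank_one_sets F R. localizations_at_max F (ring_of_valuations X) = X) \<and>
         (\<forall>A \<in> one_dim_prufer_overrings_jac F R. ring_of_valuations (localizations_at_max F A) = A)"
proof -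
  interpret ambient_field F by (rule ambient_field.intro) (rule assms(1))
  let ?C = "compact_rank_one_sets F R" and ?P = "one_dim_prufer_overrings_jac F R"
  have C: "ring_of_valuations X \<in> ?P" "localizations_at_max F (ring_of_valuations X) = X"
    if "X \<in> ?C" for X
    using intersection_of_compact_rank_one_set[OF assms(2,4) that] by blast+
  have P: "localizations_at_max F A \<in> ?C" "ring_of_valuations (localizations_at_max F A) = A"
    if "A \<in> ?P" for A
  proof -
    show "localizations_at_max F A \<in> ?C" by (rule localizations_at_max_in_compact_sets[OF assms(4) that])
    have "subring A F" using that by (auto simp: one_dim_prufer_overrings_jac_def overrings_def)
    then show "ring_of_valuations (localizations_at_max F A) = A"
      by (rule Inter_localizations_at_max)
  qed
  have "bij_betw ring_of_valuations ?C ?P"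
    by (rule bij_betw_byWitness[where f' = "localizations_at_max F"];
        intro ballI image_subsetI C P; assumption)
  moreover have "bij_betw (localizations_at_max F) ?P ?C"
    by (rule bij_betw_byWitness[where f' = ring_of_valuations];
        intro ballI image_subsetI C P; assumption)
  ultimately show ?thesis by (intro conjI ballI C(2) P(2))
qed

end
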